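(* Let $\succ$ be a binary relation on $\mathcal{F}$ admitting a hope-and-prepare representation $(u,C,D)$, i.e. $u:X\to\mathbb{R}$ non-constant affine, $C,D\subseteq\Delta$ convex compact with $C\cap D\neq\emptyset$, and for all $f,g\in\mathcal{F}$: $f\succ g$ iff $\min_{p\in C}\int u(f)\,dp>\min_{p\in C}\int u(g)\,dp$ and $\max_{p\in D}\int u(f)\,dp>\max_{p\in D}\int u(g)\,dp$; assume this representation is unique ($u$ unique up to positive affine transformation, $C$ and $D$ unique). Then: (i) $\succ$ satisfies Axiom A8 if and only if $D\subseteq C$; (ii) $\succ$ satisfies Axiom A9 if and only if $C\subseteq D$. In particular, a binary relation $\succ$ on $\mathcal{F}$ satisfies Axioms A1–A9 if and only if there exist a non-constant affine $u:X\to\mathbb{R}$, unique up to positive affine transformation, and a unique convex compact $C\subseteq\Delta$ such that for all $f,g\in\mathcal{F}$, $$f\succ g\iff \begin{cases}\min_{p\in C}\int u(f)\,dp>\min_{p\in C}\int u(g)\,dp,\\ \max_{p\in C}\int u(f)\,dp>\max_{p\in C}\int u(g)\,dp.\end{cases}$$ Axioms: (A1) $\succ$ is asymmetric and transitive, and its restriction to $X$ is non-trivial and negatively transitive. (A2) For all $f,g,h\in\mathcal{F}$, $\{\alpha\in[0,1]:\alpha f+(1-\alpha)g\succ h\}$ and $\{\alpha\in[0,1]:h\succ\alpha f+(1-\alpha)g\}$ are open in $[0,1]$. (A3) For all $f,g\in\mathcal{F}$, $x\in X$, $\alpha\in(0,1)$: $f\succ g$ iff $\alpha f+(1-\alpha)x\succ\alpha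 g+(1-\alpha)x$. (A4) For all $x\in X$, $\{f:f\succ x\}$ and $\{f:x\succ f\}$ are convex. (A5) If $f(s)\succ g(s)$ for all $s\in S$ then $f\succ g$. (A6) If for all $x\in X$, $f\Join x$ implies $g\Join x$, then $f\Join g$. (A7) If $f\Join x$, $x\succ g$, $g\Join y$, $f\succ y$ (with $x,y\in X$), then $f\succ g$. (A8) If $f,g\in\mathcal{F}$ are complementary, then $f\succ\frac12 f+\frac12 g$ implies $\frac12 f+\frac12 g\succ g$. (A9) If $f,g\in\mathcal{F}$ are complementary, then $\frac12 f+\frac12 g\succ g$ implies $f\succ\frac12 f+\frac12 g$.
   Context: $S$ is a set of states with algebra $\Sigma$; $X$ is a non-singleton convex subset of a real vector space; $\mathcal{F}$ is the set of simple ($\Sigma$-measurable, finitely-valued) acts $f:S\to X$, with pointwise mixtures; each $x\in X$ is identified with the corresponding constant act. $\Delta$ is the set of finitely additive probability measures on $(S,\Sigma)$ with the weak* topology. $f\Join g$ means $f\not\succ g$ and $g\not\succ f$. On $X$, write $x\sim y$ iff $x\Join y$. Two acts $f,g$ are complementary if $\frac12 f(s)+\frac12 g(s)\sim\frac12 f(s')+\frac12 g(s')$ for all $s,s'\in S$. *)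

theory Defs
  imports "HOL-Analysis.Analysis"
begin

text \<open>States: type 'a (S = UNIV), algebra Sig on it. Outcomes X: convex subset of a real
  vector space 'b. Acts are functions 'a => 'b.\<close>

definition cact :: "'b \<Rightarrow> ('a \<Rightarrow> 'b)" where
  "cact x = (\<lambda>s. x)"

definition mixa :: "real \<Rightarrow> ('a \<Rightarrow> 'b::real_vector) \<Rightarrow> ('a \<Rightarrow> 'b) \<Rightarrow> ('a \<Rightarrow> 'b)" where
  "mixa \<alpha> f g = (\<lambda>s. \<alpha> *\<^sub>R f s + (1 - \<alpha>) *\<^sub>R g s)"

definition simple_acts :: "'a set set \<Rightarrow> 'b set \<Rightarrow> ('a \<Rightarrow> 'b) set" where
  "simple_acts Sig X = {f. finite (range f) \<and> range f \<subseteq> X \<and> (\<forall>x. f -` {x} \<in> Sig)}"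

text \<open>Finitely additive probability measures on (UNIV, Sig); normalised to be 0 off Sig.\<close>
definition fa_probs :: "'a set set \<Rightarrow> ('a set \<Rightarrow> real) set" where
  "fa_probs Sig = {p. (\<forall>A. A \<notin> Sig \<longrightarrow> p A = 0) \<and> (\<forall>A\<in>Sig. 0 \<le> p A) \<and> p UNIV = 1 \<and>
      (\<forall>A\<in>Sig. \<forall>B\<in>Sig. A \<inter> B = {} \<longrightarrow> p (A \<union> B) = p A + p B)}"

definition sint :: "('a set \<Rightarrow> real) \<Rightarrow> ('a \<Rightarrow> real) \<Rightarrow> real" where
  "sint p h = (\<Sum>v\<in>range h. v * p (h -` {v}))"

definition convex_meas :: "('a set \<Rightarrow> real) set \<Rightarrow> bool" where
  "convex_meas C \<longleftrightarrow> (\<forall>p\<in>C. \<forall>q\<in>C. \<forall>\<alpha>::real. 0 \<le> \<alpha> \<and> \<alpha> \<le> 1 \<longrightarrow>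
      (\<lambda>A. \<alpha> * p A + (1 - \<alpha>) * q A) \<in> C)"

text \<open>min / max of expected utility over a (nonempty compact) set of measures.\<close>
definition minEU :: "('a set \<Rightarrow> real) set \<Rightarrow> ('b \<Rightarrow> real) \<Rightarrow> ('a \<Rightarrow> 'b) \<Rightarrow> real" where
  "minEU C u f = Inf ((\<lambda>p. sint p (u \<circ> f)) ` C)"

definition maxEU :: "('a set \<Rightarrow> real) set \<Rightarrow> ('b \<Rightarrow> real) \<Rightarrow> ('a \<Rightarrow> 'b) \<Rightarrow> real" where
  "maxEU C u f = Sup ((\<lambda>p. sint p (u \<circ> f)) ` C)"

definition affine_on :: "'b::real_vector set \<Rightarrow> ('b \<Rightarrow> real) \<Rightarrow> bool" where
  "affine_on X u \<longleftrightarrow> (\<forall>x\<in>X. \<forall>y\<in>X. \<forall>\<alpha>::real. 0 \<le> \<alpha> \<and> \<alpha> \<le> 1 \<longrightarrow>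
      u (\<alpha> *\<^sub>R x + (1 - \<alpha>) *\<^sub>R y) = \<alpha> * u x + (1 - \<alpha>) * u y)"

definition nonconst_on :: "'b set \<Rightarrow> ('b \<Rightarrow> real) \<Rightarrow> bool" where
  "nonconst_on X u \<longleftrightarrow> (\<exists>x\<in>X. \<exists>y\<in>X. u x \<noteq> u y)"

definition pos_affine_trans :: "'b set \<Rightarrow> ('b \<Rightarrow> real) \<Rightarrow> ('b \<Rightarrow> real) \<Rightarrow> bool" where
  "pos_affine_trans X u u' \<longleftrightarrow> (\<exists>a>0. \<exists>b. \<forall>x\<in>X. u' x = a * u x + b)"

definition hp_rep :: "'a set set \<Rightarrow> 'b::real_vector set \<Rightarrow> (('a \<Rightarrow> 'b) \<Rightarrow> ('a \<Rightarrow> 'b) \<Rightarrow> bool)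
    \<Rightarrow> ('b \<Rightarrow> real) \<Rightarrow> ('a set \<Rightarrow> real) set \<Rightarrow> ('a set \<Rightarrow> real) set \<Rightarrow> bool" where
  "hp_rep Sig X R u C D \<longleftrightarrow>
     affine_on X u \<and> nonconst_on X u \<and>
     C \<subseteq> fa_probs Sig \<and> D \<subseteq> fa_probs Sig \<and>
     convex_meas C \<and> compact C \<and> convex_meas D \<and> compact D \<and> C \<inter> D \<noteq> {} \<and>
     (\<forall>f\<in>simple_acts Sig X. \<forall>g\<in>simple_acts Sig X.
        R f g \<longleftrightarrow> (minEU C u f > minEU C u g \<and> maxEU D u f > maxEU D u g))"

definition hp_rep_unique :: "'a set set \<Rightarrow> 'b::real_vector set \<Rightarrow> (('a \<Rightarrow> 'b) \<Rightarrow> ('a \<Rightarrow> 'b) \<Rightarrow> bool)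
    \<Rightarrow> ('b \<Rightarrow> real) \<Rightarrow> ('a set \<Rightarrow> real) set \<Rightarrow> ('a set \<Rightarrow> real) set \<Rightarrow> bool" where
  "hp_rep_unique Sig X R u C D \<longleftrightarrow>
     (\<forall>u' C' D'. hp_rep Sig X R u' C' D' \<longrightarrow> pos_affine_trans X u u' \<and> C' = C \<and> D' = D)"

definition incomp :: "(('a \<Rightarrow> 'b) \<Rightarrow> ('a \<Rightarrow> 'b) \<Rightarrow> bool) \<Rightarrow> ('a \<Rightarrow> 'b) \<Rightarrow> ('a \<Rightarrow> 'b) \<Rightarrow> bool" where
  "incomp R f g \<longleftrightarrow> \<not> R f g \<and> \<not> R g f"

definition complementary :: "(('a \<Rightarrow> 'b::real_vector) \<Rightarrow> ('a \<Rightarrow> 'b) \<Rightarrow> bool) \<Rightarrow> ('a \<Rightarrow> 'b) \<Rightarrow> ('a \<Rightarrow> 'b) \<Rightarrow> bool" where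
  "complementary R f g \<longleftrightarrow> (\<forall>s s'.
     incomp R (cact ((1/2) *\<^sub>R f s + (1/2) *\<^sub>R g s)) (cact ((1/2) *\<^sub>R f s' + (1/2) *\<^sub>R g s')))"

definition A1 where
  "A1 Sig X R \<longleftrightarrow>
     (\<forall>f\<in>simple_acts Sig X. \<forall>g\<in>simple_acts Sig X. R f g \<longrightarrow> \<not> R g f) \<and>
     (\<forall>f\<in>simple_acts Sig X. \<forall>g\<in>simple_acts Sig X. \<forall>h\<in>simple_acts Sig X.
        R f g \<and> R g h \<longrightarrow> R f h) \<and>
     (\<exists>x\<in>X. \<exists>y\<in>X. R (cact x) (cact y)) \<and>
     (\<forall>x\<in>X. \<forall>y\<in>X. \<forall>z\<in>X. \<not> R (cact x) (cact y) \<and> \<not> R (cact y) (cact z)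
        \<longrightarrow> \<not> R (cact x) (cact z))"

definition A2 where
  "A2 Sig X R \<longleftrightarrow>
     (\<forall>f\<in>simple_acts Sig X. \<forall>g\<in>simple_acts Sig X. \<forall>h\<in>simple_acts Sig X.
        openin (top_of_set {0..1::real}) {\<alpha>\<in>{0..1}. R (mixa \<alpha> f g) h} \<and>
        openin (top_of_set {0..1::real}) {\<alpha>\<in>{0..1}. R h (mixa \<alpha> f g)})"

definition A3 where
  "A3 Sig X R \<longleftrightarrow>
     (\<forall>f\<in>simple_acts Sig X. \<forall>g\<in>simple_acts Sig X. \<forall>x\<in>X. \<forall>\<alpha>\<in>{0<..<1::real}.
        R f g \<longleftrightarrow> R (mixa \<alpha> f (cact x)) (mixa \<alpha> g (cact x)))"

definition A4 where
  "A4 Sig X R \<longleftrightarrow>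
     (\<forall>x\<in>X. \<forall>f\<in>simple_acts Sig X. \<forall>g\<in>simple_acts Sig X. \<forall>\<alpha>\<in>{0..1::real}.
        (R f (cact x) \<and> R g (cact x) \<longrightarrow> R (mixa \<alpha> f g) (cact x)) \<and>
        (R (cact x) f \<and> R (cact x) g \<longrightarrow> R (cact x) (mixa \<alpha> f g)))"

definition A5 where
  "A5 Sig X R \<longleftrightarrow>
     (\<forall>f\<in>simple_acts Sig X. \<forall>g\<in>simple_acts Sig X.
        (\<forall>s. R (cact (f s)) (cact (g s))) \<longrightarrow> R f g)"

definition A6 where
  "A6 Sig X R \<longleftrightarrow>
     (\<forall>f\<in>simple_acts Sig X. \<forall>g\<in>simple_acts Sig X.
        (\<forall>x\<in>X. incomp R f (cact x) \<longrightarrow> incomp R g (cact x)) \<longrightarrow> incomp R f g)"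

definition A7 where
  "A7 Sig X R \<longleftrightarrow>
     (\<forall>f\<in>simple_acts Sig X. \<forall>g\<in>simple_acts Sig X. \<forall>x\<in>X. \<forall>y\<in>X.
        incomp R f (cact x) \<and> R (cact x) g \<and> incomp R g (cact y) \<and> R f (cact y) \<longrightarrow> R f g)"

definition A8 where
  "A8 Sig X R \<longleftrightarrow>
     (\<forall>f\<in>simple_acts Sig X. \<forall>g\<in>simple_acts Sig X. complementary R f g \<longrightarrow>
        R f (mixa (1/2) f g) \<longrightarrow> R (mixa (1/2) f g) g)"

definition A9 where
  "A9 Sig X R \<longleftrightarrow>
     (\<forall>f\<in>simple_acts Sig X. \<forall>g\<in>simple_acts Sig X. complementary R f g \<longrightarrow>
        R (mixa (1/2) f g) g \<longrightarrow> R f (mixa (1/2) f g))"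

end

theory Submission
  imports Defs
begin

text \<open>
  For complementary acts \<open>f\<close>, \<open>g\<close> with constant average utility \<open>k\<close>, preferring \<open>f\<close> to the mixture
  means that the minimum over \<open>C\<close> of the expected utility of \<open>f\<close> exceeds \<open>k\<close>, and preferring the
  mixture to \<open>g\<close> means the same for the minimum over \<open>D\<close>. So A8 and A9 compare the positivity sets
  of two support functions, and separation of compact convex sets of measures turns this into
  inclusion. Separation, and likewise the representation of a monotone superlinear functional as a
  minimum of integrals, comes from a theorem of the alternative: reduce to finitely many
  constraints by compactness, minimise the sum of the squared violations, and read the multipliers
  off the first-order condition at the minimiser.

  Conversely, the axioms restricted to constants give an affine utility \<open>u\<close>. The
  preference then depends only on utility profiles and becomes a monotone, positively homogeneous relation \<open>Q\<close> on simple functions, invariant under adding constants. Put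
  \<open>I \<phi> = Sup {t. Q \<phi> t}\<close>. By A4 this is superlinear, hence a minimum over a set \<open>C\<close>. By A8 and A9 the
  relation of \<open>t\<close> to \<open>\<phi>\<close> is that of \<open>t - \<phi>\<close> to \<open>0\<close>, so the same \<open>C\<close> governs the dual functional
  \<open>- I (- \<phi>)\<close>, a maximum. A7 and continuity reduce \<open>Q \<phi> \<psi>\<close> to comparing both functionals.
\<close>

section \<open>Simple functions and integrals against finitely additive probabilities\<close>

definition simp_fun :: "'a set set \<Rightarrow> ('a \<Rightarrow> 'c) \<Rightarrow> bool" where
  "simp_fun Sig f \<longleftrightarrow> finite (range f) \<and> (\<forall>v. f -` {v} \<in> Sig)"

lemma simple_acts_iff: "f \<in> simple_acts Sig X \<longleftrightarrow> simp_fun Sig f \<and> (\<forall>s. f s \<in> X)"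
  by (auto simp: simple_acts_def simp_fun_def)

lemma simp_fun_vimage:
  assumes Sig: "algebra UNIV Sig" and f: "simp_fun Sig f"
  shows "f -` B \<in> Sig"
proof -
  interpret algebra UNIV Sig by fact
  have "f -` B = (\<Union>v\<in>range f \<inter> B. f -` {v})" by auto
  also have "\<dots> \<in> Sig"
    using f by (intro finite_UN) (auto simp: simp_fun_def)
  finally show ?thesis .
qed

lemma simp_fun_comp:
  assumes "algebra UNIV Sig" and "simp_fun Sig f"
  shows "simp_fun Sig (\<lambda>s. h (f s))"
proof -
  have "range (\<lambda>s. h (f s)) = h ` range f" by auto
  moreover have "(\<lambda>s. h (f s)) -` {v} = f -` (h -` {v})" for v by auto
  ultimately show ?thesis
    using assms simp_fun_vimage[OF assms] by (simp add: simp_fun_def)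
qed

lemma simp_fun_Pair:
  assumes Sig: "algebra UNIV Sig" and f: "simp_fun Sig f" and g: "simp_fun Sig g"
  shows "simp_fun Sig (\<lambda>s. (f s, g s))"
proof -
  interpret algebra UNIV Sig by fact
  have "finite (range (\<lambda>s. (f s, g s)))"
    by (rule finite_subset[of _ "range f \<times> range g"]) (use f g in \<open>auto simp: simp_fun_def\<close>)
  moreover have "(\<lambda>s. (f s, g s)) -` {v} = f -` {fst v} \<inter> g -` {snd v}" for v
    by (cases v) auto
  ultimately show ?thesis using f g by (auto simp: simp_fun_def)
qed

lemma simp_fun_comp2:
  assumes "algebra UNIV Sig" and "simp_fun Sig f" and "simp_fun Sig g"
  shows "simp_fun Sig (\<lambda>s. h (f s) (g s))"
  using simp_fun_comp[OF assms(1) simp_fun_Pair[OF assms], of "\<lambda>z. h (fst z) (snd z)"] by simp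

lemma simp_fun_const: "algebra UNIV Sig \<Longrightarrow> simp_fun Sig (\<lambda>s. x)"
  by (auto simp: simp_fun_def algebra_iff_Un)

lemma simp_fun_sum:
  fixes \<phi> :: "'i \<Rightarrow> 'a \<Rightarrow> real"
  assumes "algebra UNIV Sig" and "finite F" and "\<And>i. i \<in> F \<Longrightarrow> simp_fun Sig (\<phi> i)"
  shows "simp_fun Sig (\<lambda>s. \<Sum>i\<in>F. l i * \<phi> i s)"
  using assms(2,3)
  by (induction F rule: finite_induct)
    (auto intro!: simp_fun_const simp_fun_comp2[where h = "(+)"] simp_fun_comp[where h = "(*) _"] assms(1))

lemma simp_fun_bounded:
  fixes \<phi> :: "'a \<Rightarrow> real"
  assumes "simp_fun Sig \<phi>"
  obtains M where "M > 0" "\<And>s. \<bar>\<phi> s\<bar> \<le> M"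
proof -
  have "bounded (range \<phi>)" using assms by (auto simp: simp_fun_def intro: finite_imp_bounded)
  then show ?thesis using that by (auto simp: bounded_pos)
qed

lemma fa_probs_finite_Union:
  assumes Sig: "algebra UNIV Sig" and p: "p \<in> fa_probs Sig" and "finite F"
    and "\<And>i. i \<in> F \<Longrightarrow> A i \<in> Sig" and "disjoint_family_on A F"
  shows "p (\<Union>i\<in>F. A i) = (\<Sum>i\<in>F. p (A i))"
proof -
  interpret algebra UNIV Sig by fact
  have E: "p {} = 0"
  proof -
    have "\<forall>A\<in>Sig. \<forall>B\<in>Sig. A \<inter> B = {} \<longrightarrow> p (A \<union> B) = p A + p B"
      using p by (simp add: fa_probs_def)
    from this[rule_format, of "{}" "{}"] show ?thesis by simp
  qed
  show ?thesis using assms(3-5)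
  proof (induction F rule: finite_induct)
    case empty then show ?case using E by simp
  next
    case (insert i F)
    have "A i \<inter> (\<Union>j\<in>F. A j) = {}"
      using insert.hyps insert.prems(2) by (auto simp: disjoint_family_on_def)
    moreover have "A i \<in> Sig" "(\<Union>j\<in>F. A j) \<in> Sig" using insert by auto
    ultimately have "p (A i \<union> (\<Union>j\<in>F. A j)) = p (A i) + p (\<Union>j\<in>F. A j)"
      using p by (auto simp: fa_probs_def)
    moreover have "disjoint_family_on A F"
      using insert.prems(2) by (auto simp: disjoint_family_on_def)
    ultimately show ?case using insert by simp
  qed
qed

text \<open>Finite additivity splits each level set of the composite into level sets of
  \<open>w\<close>. Applied to a pair of functions, this puts both integrands over one common
  partition, where linearity and monotonicity hold termwise.\<close>

lemma sint_comp:
  assumes Sig: "algebra UNIV Sig" and p: "p \<in> fa_probs Sig" and w: "simp_fun Sig w"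
  shows "sint p (\<lambda>s. h (w s)) = (\<Sum>z\<in>range w. h z * p (w -` {z}))"
proof -
  have fin: "finite (range w)" using w by (simp add: simp_fun_def)
  have rg: "range (\<lambda>s. h (w s)) = h ` range w" by auto
  have "sint p (\<lambda>s. h (w s)) = (\<Sum>v\<in>h ` range w. v * p ((\<lambda>s. h (w s)) -` {v}))"
    by (simp add: sint_def rg)
  also have "\<dots> = (\<Sum>v\<in>h ` range w. \<Sum>z\<in>{z\<in>range w. h z = v}. h z * p (w -` {z}))"
  proof (rule sum.cong)
    fix v
    have "(\<lambda>s. h (w s)) -` {v} = (\<Union>z\<in>{z\<in>range w. h z = v}. w -` {z})" by auto
    then have "p ((\<lambda>s. h (w s)) -` {v}) = (\<Sum>z\<in>{z\<in>range w. h z = v}. p (w -` {z}))"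
      using w fin
      by (simp only:, intro fa_probs_finite_Union[OF Sig p])
        (auto simp: simp_fun_def disjoint_family_on_def)
    then show "v * p ((\<lambda>s. h (w s)) -` {v}) = (\<Sum>z\<in>{z\<in>range w. h z = v}. h z * p (w -` {z}))"
      by (simp add: sum_distrib_left)
  qed simp
  also have "\<dots> = (\<Sum>z\<in>range w. h z * p (w -` {z}))"
    by (rule sum.image_gen[symmetric, OF fin])
  finally show ?thesis .
qed

lemma sint_comp2:
  assumes "algebra UNIV Sig" and "p \<in> fa_probs Sig" and "simp_fun Sig f" and "simp_fun Sig g"
  shows "sint p (\<lambda>s. h (f s) (g s)) =
    (\<Sum>z\<in>range (\<lambda>s. (f s, g s)). h (fst z) (snd z) * p ((\<lambda>s. (f s, g s)) -` {z}))"
  using sint_comp[OF assms(1,2) simp_fun_Pair[OF assms(1,3,4)], of "\<lambda>z. h (fst z) (snd z)"] by simp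

lemma sint_lin:
  assumes "algebra UNIV Sig" and "p \<in> fa_probs Sig" and "simp_fun Sig f" and "simp_fun Sig g"
  shows "sint p (\<lambda>s. a * f s + b * g s) = a * sint p f + b * sint p g"
  using sint_comp2[OF assms, of "\<lambda>x y. a * x + b * y"] sint_comp2[OF assms, of "\<lambda>x y. x"]
    sint_comp2[OF assms, of "\<lambda>x y. y"]
  by (simp add: sum_distrib_left sum.distrib algebra_simps)

lemma sint_mono:
  assumes "algebra UNIV Sig" and p: "p \<in> fa_probs Sig" and "simp_fun Sig f" and "simp_fun Sig g"
    and le: "\<And>s. f s \<le> g s"
  shows "sint p f \<le> sint p g"
proof -
  have "0 \<le> p ((\<lambda>s. (f s, g s)) -` {z})" for z
    using p simp_fun_Pair[OF assms(1,3,4)] by (auto simp: fa_probs_def simp_fun_def)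
  then show ?thesis
    using sint_comp2[OF assms(1-4), of "\<lambda>x y. x"] sint_comp2[OF assms(1-4), of "\<lambda>x y. y"] le
    by (auto intro!: sum_mono mult_right_mono)
qed

lemma sint_const:
  assumes "p \<in> fa_probs Sig"
  shows "sint p (\<lambda>s. c) = c"
  using assms by (simp add: sint_def fa_probs_def)

lemma sint_affine:
  assumes "algebra UNIV Sig" and "p \<in> fa_probs Sig" and "simp_fun Sig f"
  shows "sint p (\<lambda>s. a * f s + b) = a * sint p f + b"
  using sint_lin[OF assms simp_fun_const[OF assms(1), of 1], of a b] sint_const[OF assms(2), of 1]
  by simp

lemma sint_sum:
  assumes Sig: "algebra UNIV Sig" and p: "p \<in> fa_probs Sig"
    and "finite F" and "\<And>i. i \<in> F \<Longrightarrow> simp_fun Sig (\<phi> i)"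
  shows "sint p (\<lambda>s. \<Sum>i\<in>F. l i * \<phi> i s) = (\<Sum>i\<in>F. l i * sint p (\<phi> i))"
  using assms(3,4)
proof (induction F rule: finite_induct)
  case empty then show ?case using sint_const[OF p, of 0] by simp
next
  case (insert i F)
  then show ?case
    using sint_lin[OF Sig p insert.prems[of i] simp_fun_sum[OF Sig insert.hyps(1), of \<phi> l], of "l i" 1] 
    by simp
qed

lemma sint_mix:
  "sint (\<lambda>A. \<alpha> * p A + (1 - \<alpha>) * q A) f = \<alpha> * sint p f + (1 - \<alpha>) * sint q f"
  by (simp add: sint_def sum_distrib_left sum.distrib algebra_simps sum_subtractf)

text \<open>The integral is a finite linear combination of evaluations at sets (0 by convention if
  the range is infinite), and evaluations are the coordinates of the product topology, which stands
  for the weak star topology here.\<close>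

lemma continuous_on_sint: "continuous_on K (\<lambda>p. sint p f)"
  unfolding sint_def
  by (intro continuous_intros) (auto intro: continuous_on_product_coordinates continuous_on_subset)

text \<open>Tychonoff: a closed subset of a product of unit intervals. Coordinates outside
  \<open>Sig\<close> are bounded as well because measures are normalised to 0 there.\<close>

lemma compact_fa_probs:
  assumes Sig: "algebra UNIV Sig"
  shows "compact (fa_probs Sig)"
proof -
  interpret algebra UNIV Sig by fact
  have co: "continuous_on UNIV (\<lambda>p. p A)" for A :: "'a set"
    by (rule continuous_on_product_coordinates)
  have "compact (\<Pi>\<^sub>E A\<in>(UNIV::'a set set). {0..1::real})"
    using compactin_PiE[of "\<lambda>A. euclidean" UNIV "\<lambda>A. {0..1::real}"]
    unfolding euclidean_product_topology compactin_euclidean_iff by auto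
  moreover have "closed (fa_probs Sig)"
  proof -
    have eq: "fa_probs Sig = (\<Inter>A\<in>-Sig. {p. p A = 0}) \<inter> (\<Inter>A\<in>Sig. {p. 0 \<le> p A}) \<inter> {p. p UNIV = 1}
      \<inter> (\<Inter>A\<in>Sig. \<Inter>B\<in>{B\<in>Sig. A \<inter> B = {}}. {p. p (A \<union> B) = p A + p B})"
      by (auto simp: fa_probs_def)
    show ?thesis unfolding eq
      by (intro closed_Int closed_INT ballI closed_Collect_eq closed_Collect_le
          continuous_on_add continuous_on_const co)
  qed
  moreover have "fa_probs Sig \<subseteq> (\<Pi>\<^sub>E A\<in>UNIV. {0..1})"
  proof
    fix p assume p: "p \<in> fa_probs Sig"
    have "0 \<le> p A \<and> p A \<le> 1" for A
    proof (cases "A \<in> Sig")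
      case True
      have "\<forall>A\<in>Sig. \<forall>B\<in>Sig. A \<inter> B = {} \<longrightarrow> p (A \<union> B) = p A + p B"
        using p by (simp add: fa_probs_def)
      from this[rule_format, of A "UNIV - A"] True
      have "p (A \<union> (UNIV - A)) = p A + p (UNIV - A)" by auto
      moreover have "0 \<le> p (UNIV - A)" using p True by (auto simp: fa_probs_def)
      moreover have "A \<union> (UNIV - A) = UNIV" by auto
      ultimately have "1 = p A + p (UNIV - A)" "0 \<le> p (UNIV - A)" using p by (auto simp: fa_probs_def)
      then show ?thesis using p True by (auto simp: fa_probs_def)
    qed (use p in \<open>auto simp: fa_probs_def\<close>)
    then show "p \<in> (\<Pi>\<^sub>E A\<in>UNIV. {0..1})" by (auto simp: PiE_UNIV_domain)
  qed
  ultimately show ?thesis by (metis compact_Int_closed inf.absorb2)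
qed

section \<open>Separation and support by probabilities\<close>

lemma separation_alternative:
  fixes c :: "('a \<Rightarrow> real) \<Rightarrow> real"
  assumes K: "compact K" "convex_meas K"
    and none: "\<not> (\<exists>p\<in>K. \<forall>\<phi>\<in>T. c \<phi> \<le> sint p \<phi>)"
  obtains F l where "finite F" "F \<subseteq> T" "\<And>\<phi>. 0 \<le> l \<phi>"
    "\<And>q. q \<in> K \<Longrightarrow> (\<Sum>\<phi>\<in>F. l \<phi> * sint q \<phi>) < (\<Sum>\<phi>\<in>F. l \<phi> * c \<phi>)"
proof (cases "K = {}")
  case True
  then show ?thesis using that[of "{}" "\<lambda>_. 0"] by auto
next
  case False
  have cl: "closed {p. c \<phi> \<le> sint p \<phi>}" for \<phi>
    by (intro closed_Collect_le continuous_on_sint continuous_intros)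
  \<comment> \<open>The constraint sets are closed, so by the finite intersection property an
    infeasible family has an infeasible finite subfamily.\<close>
  have "\<exists>F. finite F \<and> F \<subseteq> T \<and> K \<inter> (\<Inter>\<phi>\<in>F. {p. c \<phi> \<le> sint p \<phi>}) = {}"
  proof (rule ccontr)
    assume "\<not> ?thesis"
    then have nF: "\<And>F. finite F \<Longrightarrow> F \<subseteq> T \<Longrightarrow> K \<inter> (\<Inter>\<phi>\<in>F. {p. c \<phi> \<le> sint p \<phi>}) \<noteq> {}" by blast
    have "K \<inter> (\<Inter>\<phi>\<in>T. {p. c \<phi> \<le> sint p \<phi>}) \<noteq> {}"
      by (rule compact_imp_fip_image[OF K(1) cl nF])
    with none show False by auto
  qed
  then obtain F where F: "finite F" "F \<subseteq> T" "K \<inter> (\<Inter>\<phi>\<in>F. {p. c \<phi> \<le> sint p \<phi>}) = {}"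
    by (elim exE conjE)
  \<comment> \<open>The total squared violation of the finitely many constraints; it is positive
    everywhere on \<open>K\<close>.\<close>
  define G where "G p = (\<Sum>\<phi>\<in>F. (max 0 (c \<phi> - sint p \<phi>))\<^sup>2)" for p
  have "continuous_on K G" unfolding G_def
    by (intro continuous_intros continuous_on_sint)
  then obtain p0 where p0: "p0 \<in> K" "\<And>q. q \<in> K \<Longrightarrow> G p0 \<le> G q"
    using continuous_attains_inf[OF K(1) False] by blast
  \<comment> \<open>The violations left at the minimiser are, up to a factor 2, the derivatives of
    the penalty with respect to the individual violations. Hence they serve as multipliers.\<close>
  define l where "l \<phi> = max 0 (c \<phi> - sint p0 \<phi>)" for \<phi>
  obtain \<phi>0 where "\<phi>0 \<in> F" "sint p0 \<phi>0 < c \<phi>0" using F(3) p0(1) by fastforce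
  then have "0 < (\<Sum>\<phi>\<in>F. l \<phi> * (c \<phi> - sint p0 \<phi>))"
    by (intro sum_pos2[OF F(1), of \<phi>0]) (auto simp: l_def max_def)
  then have strict: "(\<Sum>\<phi>\<in>F. l \<phi> * sint p0 \<phi>) < (\<Sum>\<phi>\<in>F. l \<phi> * c \<phi>)"
    by (simp add: algebra_simps sum_subtractf)
  have "(\<Sum>\<phi>\<in>F. l \<phi> * sint q \<phi>) \<le> (\<Sum>\<phi>\<in>F. l \<phi> * sint p0 \<phi>)" if q: "q \<in> K" for q
  proof -
    \<comment> \<open>A move from \<open>p0\<close> towards \<open>q\<close> by \<alpha> raises the
      signed violation of \<phi> by \<alpha> times \<open>y \<phi>\<close>. The penalty along this
      segment is majorised by a quadratic in \<alpha> with linear coefficient \<open>2 * a\<close>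
      and quadratic coefficient \<open>b\<close>.\<close>
    define y where "y \<phi> = sint p0 \<phi> - sint q \<phi>" for \<phi>
    define a where "a = (\<Sum>\<phi>\<in>F. l \<phi> * y \<phi>)"
    define b where "b = (\<Sum>\<phi>\<in>F. (y \<phi>)\<^sup>2)"
    have step: "0 \<le> 2 * a + \<alpha> * b" if \<alpha>: "0 < \<alpha>" "\<alpha> \<le> 1" for \<alpha>
    proof -
      have "(\<lambda>A. \<alpha> * q A + (1 - \<alpha>) * p0 A) \<in> K"
        using K(2) q p0(1) \<alpha> by (auto simp: convex_meas_def)
      then have "G p0 \<le> G (\<lambda>A. \<alpha> * q A + (1 - \<alpha>) * p0 A)" by (rule p0(2))
      also have "\<dots> \<le> (\<Sum>\<phi>\<in>F. (l \<phi> + \<alpha> * y \<phi>)\<^sup>2)"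
        unfolding G_def
      proof (rule sum_mono)
        fix \<phi>
        have eq: "c \<phi> - sint (\<lambda>A. \<alpha> * q A + (1 - \<alpha>) * p0 A) \<phi> = (c \<phi> - sint p0 \<phi>) + \<alpha> * y \<phi>"
          unfolding sint_mix y_def by (simp add: algebra_simps)
        \<comment> \<open>If the left side is nonzero, replacing the old signed violation by its
          positive part only increases the sum. The resulting majorant is exact at \<alpha> =
          0.\<close>
        have "\<bar>max 0 ((c \<phi> - sint p0 \<phi>) + \<alpha> * y \<phi>)\<bar> \<le> \<bar>l \<phi> + \<alpha> * y \<phi>\<bar>"
          by (auto simp: l_def max_def)
        then show "(max 0 (c \<phi> - sint (\<lambda>A. \<alpha> * q A + (1 - \<alpha>) * p0 A) \<phi>))\<^sup>2 \<le> (l \<phi> + \<alpha> * y \<phi>)\<^sup>2"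
          unfolding eq by (simp only: abs_le_square_iff)
      qed
      also have "\<dots> = G p0 + 2 * \<alpha> * a + \<alpha>\<^sup>2 * b"
        by (simp add: G_def l_def a_def b_def power2_sum power_mult_distrib sum.distrib
            sum_distrib_left algebra_simps)
      finally have "0 \<le> \<alpha> * (2 * a + \<alpha> * b)" by (simp add: algebra_simps power2_eq_square)
      then show ?thesis using \<alpha> by (simp add: zero_le_mult_iff)
    qed
    have "0 \<le> a"
    proof (rule ccontr)
      assume "\<not> 0 \<le> a"
      moreover have "b \<ge> 0" by (simp add: b_def sum_nonneg)
      \<comment> \<open>Small enough that \<open>\<alpha> * b \<le> - a\<close>, with
        \<open>+ 1\<close> covering the case \<open>b = 0\<close>. Then
        \<open>2 * a + \<alpha> * b \<le> a < 0\<close> contradicts \<open>step\<close>.\<close>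
      moreover define \<alpha> where "\<alpha> = min 1 (- a / (b + 1))"
      ultimately have "0 < \<alpha>" "\<alpha> \<le> 1" "\<alpha> * b \<le> - a"
      proof -
        assume h: "\<not> 0 \<le> a" "0 \<le> b"
        show "0 < \<alpha>" using h by (simp add: \<alpha>_def divide_neg_pos)
        show "\<alpha> \<le> 1" by (simp add: \<alpha>_def)
        have "\<alpha> * b \<le> (- a / (b + 1)) * (b + 1)"
          using h by (intro mult_mono) (auto simp: \<alpha>_def divide_nonpos_pos)
        then show "\<alpha> * b \<le> - a" using h by simp
      qed
      then show False using step[of \<alpha>] \<open>\<not> 0 \<le> a\<close> by linarith
    qed
    then show ?thesis by (simp add: a_def y_def algebra_simps sum_subtractf)
  qed
  then show ?thesis
    using strict by (intro that[of F l] F(1,2)) (auto simp: l_def intro: le_less_trans)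
qed

text \<open>Indicators of sets in \<open>Sig\<close> give one inequality and their negatives the
  other; off \<open>Sig\<close> both measures vanish by normalisation.\<close>

lemma fa_probs_eqI:
  assumes Sig: "algebra UNIV Sig" and p: "p \<in> fa_probs Sig" and q: "q \<in> fa_probs Sig"
    and le: "\<And>\<phi>. simp_fun Sig \<phi> \<Longrightarrow> sint p \<phi> \<le> sint q \<phi>"
  shows "p = q"
proof
  fix A
  show "p A = q A"
  proof (cases "A \<in> Sig")
    case True
    interpret algebra UNIV Sig by fact
    have s: "simp_fun Sig (\<lambda>s. s \<in> A)"
    proof -
      have "(\<lambda>s. s \<in> A) -` {v} = (if v then A else UNIV - A)" for v by auto
      then show ?thesis using True by (auto simp: simp_fun_def intro: finite_subset[of _ UNIV])
    qed
    have ind: "sint r (\<lambda>s. of_bool (s \<in> A)) = r A" if r: "r \<in> fa_probs Sig" for r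
    proof -
      have "sint r (\<lambda>s. of_bool (s \<in> A)) = (\<Sum>z\<in>range (\<lambda>s. s \<in> A). of_bool z * r ((\<lambda>s. s \<in> A) -` {z}))"
        using sint_comp[OF Sig r s, of of_bool] .
      also have "\<dots> = (\<Sum>z\<in>UNIV. of_bool z * r ((\<lambda>s. s \<in> A) -` {z}))"
      \<comment> \<open>If \<open>A\<close> is empty or everything, one truth value is missing from
        the range; its level set is then empty and has measure 0.\<close>
      proof (rule sum.mono_neutral_left)
        have "r {} = 0" using fa_probs_finite_Union[OF Sig r, of "{}" id] by (simp add: disjoint_family_on_def)
        then show "\<forall>z\<in>UNIV - range (\<lambda>s. s \<in> A). of_bool z * r ((\<lambda>s. s \<in> A) -` {z}) = 0"
          by (auto simp: vimage_def)
      qed auto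
      also have "\<dots> = r A" by (simp add: UNIV_bool vimage_def)
      finally show ?thesis .
    qed
    have s': "simp_fun Sig (\<lambda>s. of_bool (s \<in> A) :: real)" using simp_fun_comp[OF Sig s] .
    have "p A \<le> q A" using le[OF s'] ind[OF p] ind[OF q] by simp
    moreover have "- p A \<le> - q A"
      using le[OF simp_fun_comp[OF Sig s', of "\<lambda>x. (-1) * x + 0"]] ind[OF p] ind[OF q]
      by (simp only: sint_affine[OF Sig p s'] sint_affine[OF Sig q s'])
    ultimately show ?thesis by simp
  qed (use p q in \<open>auto simp: fa_probs_def\<close>)
qed

text \<open>The bounds imposed on \<open>K\<close> are the integrals of \<open>p\<close> itself. A
  measure meeting all of them would equal \<open>p\<close>, so the alternative supplies a
  combination whose integral over every member of \<open>K\<close> is strictly below that over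
  \<open>p\<close>. Negating and shifting it gives the value 0 at \<open>p\<close>.\<close>

lemma strict_separation:
  assumes Sig: "algebra UNIV Sig" and K: "K \<subseteq> fa_probs Sig" "compact K" "convex_meas K"
    and p: "p \<in> fa_probs Sig" "p \<notin> K"
  obtains \<phi> where "simp_fun Sig \<phi>" "sint p \<phi> = 0" "\<And>q. q \<in> K \<Longrightarrow> 0 < sint q \<phi>"
proof -
  have "\<not> (\<exists>q\<in>K. \<forall>\<phi>\<in>{\<phi>. simp_fun Sig \<phi>}. sint p \<phi> \<le> sint q \<phi>)"
    using fa_probs_eqI[OF Sig p(1)] K(1) p(2) by blast
  from separation_alternative[OF K(2,3) this] obtain F l
    where F: "finite F" "F \<subseteq> {\<phi>. simp_fun Sig \<phi>}"
      and lt: "\<And>q. q \<in> K \<Longrightarrow> (\<Sum>\<phi>\<in>F. l \<phi> * sint q \<phi>) < (\<Sum>\<phi>\<in>F. l \<phi> * sint p \<phi>)"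
    by metis
  define \<psi> where "\<psi> = (\<lambda>s. \<Sum>\<phi>\<in>F. l \<phi> * \<phi> s)"
  have \<psi>: "simp_fun Sig \<psi>" unfolding \<psi>_def using F by (intro simp_fun_sum[OF Sig]) auto
  have sum: "sint q \<psi> = (\<Sum>\<phi>\<in>F. l \<phi> * sint q \<phi>)" if "q \<in> fa_probs Sig" for q
    unfolding \<psi>_def using F that by (intro sint_sum[OF Sig]) auto
  show ?thesis
  proof (rule that)
    show "simp_fun Sig (\<lambda>s. (-1) * \<psi> s + sint p \<psi>)" by (rule simp_fun_comp[OF Sig \<psi>])
    show "sint p (\<lambda>s. (-1) * \<psi> s + sint p \<psi>) = 0" by (simp only: sint_affine[OF Sig p(1) \<psi>])
    fix q assume q: "q \<in> K"
    then have q': "q \<in> fa_probs Sig" using K by auto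
    show "0 < sint q (\<lambda>s. (-1) * \<psi> s + sint p \<psi>)"
      using lt[OF q] sum[OF q'] sum[OF p(1)] by (simp only: sint_affine[OF Sig q' \<psi>])
  qed
qed

text \<open>Point masses turn inequalities valid for all probabilities into pointwise ones. The
  conjunct \<open>A \<in> Sig\<close> respects the convention that measures vanish off
  \<open>Sig\<close>.\<close>

lemma dirac_fa_prob:
  assumes Sig: "algebra UNIV Sig"
  shows "(\<lambda>A. of_bool (A \<in> Sig \<and> s \<in> A)) \<in> fa_probs Sig" (is "?d \<in> _")
    and "simp_fun Sig \<phi> \<Longrightarrow> sint (\<lambda>A. of_bool (A \<in> Sig \<and> s \<in> A)) \<phi> = \<phi> s"
proof -
  interpret algebra UNIV Sig by fact
  show "?d \<in> fa_probs Sig" by (auto simp: fa_probs_def)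
  assume f: "simp_fun Sig \<phi>"
  have "sint ?d \<phi> = (\<Sum>v\<in>range \<phi>. if v = \<phi> s then v else 0)"
    unfolding sint_def using f by (intro sum.cong) (auto simp: simp_fun_def)
  then show "sint ?d \<phi> = \<phi> s" using f by (simp add: simp_fun_def sum.delta)
qed

lemma convex_fa_probs: "algebra UNIV Sig \<Longrightarrow> convex_meas (fa_probs Sig)"
  by (auto simp: convex_meas_def fa_probs_def distrib_left add_nonneg_nonneg)

text \<open>The infeasibility certificate, tested on point masses, becomes a pointwise inequality
  between simple functions, which contradicts superlinearity of \<open>I\<close>.\<close>

lemma superlinear_supported:
  fixes I :: "('a \<Rightarrow> real) \<Rightarrow> real"
  assumes Sig: "algebra UNIV Sig" and \<phi>0: "simp_fun Sig \<phi>0"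
    and add: "\<And>\<phi> \<psi>. simp_fun Sig \<phi> \<Longrightarrow> simp_fun Sig \<psi> \<Longrightarrow> I \<phi> + I \<psi> \<le> I (\<lambda>s. \<phi> s + \<psi> s)"
    and mono: "\<And>\<phi> \<psi>. simp_fun Sig \<phi> \<Longrightarrow> simp_fun Sig \<psi> \<Longrightarrow> (\<And>s. \<phi> s \<le> \<psi> s) \<Longrightarrow> I \<phi> \<le> I \<psi>"
    and aff: "\<And>\<phi> a b. simp_fun Sig \<phi> \<Longrightarrow> 0 \<le> a \<Longrightarrow> I (\<lambda>s. a * \<phi> s + b) = a * I \<phi> + b"
  obtains p where "p \<in> fa_probs Sig" "\<And>\<phi>. simp_fun Sig \<phi> \<Longrightarrow> I \<phi> \<le> sint p \<phi>" "sint p \<phi>0 = I \<phi>0"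
proof -
  define \<phi>m where "\<phi>m = (\<lambda>s. (-1) * \<phi>0 s + 0)"
  \<comment> \<open>The raised bound at \<open>\<phi>m\<close>, the negative of
    \<open>\<phi>0\<close>, forces \<open>sint p \<phi>0 \<le> I \<phi>0\<close>, so that equality
    holds at \<open>\<phi>0\<close>. By superadditivity \<open>I \<phi>m \<le> - I \<phi>0\<close>,
    hence the bound it replaces is still implied.\<close>
  define c where "c \<phi> = (if \<phi> = \<phi>m then - I \<phi>0 else I \<phi>)" for \<phi>
  have m: "simp_fun Sig \<phi>m" unfolding \<phi>m_def by (rule simp_fun_comp[OF Sig \<phi>0])
  have Im: "I \<phi>m \<le> - I \<phi>0"
    using add[OF \<phi>0 m] aff[OF \<phi>0, of 0 0] by (simp add: \<phi>m_def)
  have "\<exists>p\<in>fa_probs Sig. \<forall>\<phi>\<in>{\<phi>. simp_fun Sig \<phi>}. c \<phi> \<le> sint p \<phi>"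
  proof (rule ccontr)
    assume none: "\<not> ?thesis"
    from separation_alternative[OF compact_fa_probs[OF Sig] convex_fa_probs[OF Sig] none] obtain F l
      where F: "finite F" "F \<subseteq> {\<phi>. simp_fun Sig \<phi>}" and l: "\<And>\<phi>. 0 \<le> l \<phi>"
        and lt: "\<And>q. q \<in> fa_probs Sig \<Longrightarrow> (\<Sum>\<phi>\<in>F. l \<phi> * sint q \<phi>) < (\<Sum>\<phi>\<in>F. l \<phi> * c \<phi>)"
      by metis
    \<comment> \<open>The term of \<open>\<phi>m\<close> is split off, since its bound is not the
      value of \<open>I\<close>; its weight is \<open>l0\<close>, or 0 if it does not occur.\<close>
    define F' where "F' = F - {\<phi>m}"
    define l0 where "l0 = (if \<phi>m \<in> F then l \<phi>m else 0)"
    have l0: "0 \<le> l0" using l by (simp add: l0_def)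
    have F': "finite F'" "\<And>\<phi>. \<phi> \<in> F' \<Longrightarrow> simp_fun Sig \<phi>" using F by (auto simp: F'_def)
    have split: "(\<Sum>\<phi>\<in>F. l \<phi> * h \<phi>) = l0 * h \<phi>m + (\<Sum>\<phi>\<in>F'. l \<phi> * h \<phi>)" for h :: "_ \<Rightarrow> real"
      using F(1) by (auto simp: F'_def l0_def sum.remove)
    define \<Phi> where "\<Phi> = (\<lambda>s. \<Sum>\<phi>\<in>F'. l \<phi> * \<phi> s)"
    have \<Phi>: "simp_fun Sig \<Phi>" unfolding \<Phi>_def using F' by (intro simp_fun_sum[OF Sig])
    have "(\<Sum>\<phi>\<in>G. l \<phi> * I \<phi>) \<le> I (\<lambda>s. \<Sum>\<phi>\<in>G. l \<phi> * \<phi> s)" if "G \<subseteq> F'" for G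
      using finite_subset[OF that F'(1)] that
    proof (induction G rule: finite_induct)
      case empty
      then show ?case using aff[OF \<phi>0, of 0 0] by simp
    next
      case (insert \<phi> G)
      have s: "simp_fun Sig \<phi>" using insert F' by auto
      have "I (\<lambda>s. l \<phi> * \<phi> s + 0) + I (\<lambda>s. \<Sum>\<phi>\<in>G. l \<phi> * \<phi> s) \<le>
          I (\<lambda>s. (l \<phi> * \<phi> s + 0) + (\<Sum>\<phi>\<in>G. l \<phi> * \<phi> s))"
        using insert F' by (intro add simp_fun_comp[OF Sig s] simp_fun_sum[OF Sig]) auto
      then show ?case using insert aff[OF s l, of \<phi> 0] by simp
    qed
    from this[of F'] have I\<Phi>: "(\<Sum>\<phi>\<in>F'. l \<phi> * I \<phi>) \<le> I \<Phi>" by (simp add: \<Phi>_def)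
    define \<Psi> where "\<Psi> = (\<lambda>s. \<Phi> s - l0 * \<phi>0 s)"
    have "simp_fun Sig \<Psi>" unfolding \<Psi>_def by (rule simp_fun_comp2[OF Sig \<Phi> \<phi>0])
    then have "finite (range \<Psi>)" by (simp add: simp_fun_def)
    then obtain s0 where s0: "\<And>s. \<Psi> s \<le> \<Psi> s0"
      using Max_in[of "range \<Psi>"] Max_ge[of "range \<Psi>"] by fastforce
    \<comment> \<open>The certificate is tested on the point mass at a state where
      \<open>\<Psi>\<close> is largest.\<close>
    have "\<Psi> s0 < (\<Sum>\<phi>\<in>F. l \<phi> * c \<phi>)"
    proof -
      let ?d = "\<lambda>A. of_bool (A \<in> Sig \<and> s0 \<in> A) :: real"
      have "(\<Sum>\<phi>\<in>F. l \<phi> * sint ?d \<phi>) = (\<Sum>\<phi>\<in>F. l \<phi> * \<phi> s0)"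
        using F dirac_fa_prob(2)[OF Sig] by (intro sum.cong) auto
      also have "\<dots> = \<Psi> s0" by (simp add: split[of "\<lambda>\<phi>. \<phi> s0"] \<Psi>_def \<Phi>_def \<phi>m_def)
      finally show ?thesis using lt[OF dirac_fa_prob(1)[OF Sig, of s0]] by simp
    qed
    also have "(\<Sum>\<phi>\<in>F. l \<phi> * c \<phi>) = - l0 * I \<phi>0 + (\<Sum>\<phi>\<in>F'. l \<phi> * I \<phi>)"
      by (simp add: split c_def F'_def)
    finally have "\<Psi> s0 + l0 * I \<phi>0 < I \<Phi>" using I\<Phi> by simp
    \<comment> \<open>Maximality of \<open>\<Psi> s0\<close> says that \<open>\<Phi>\<close> lies
      pointwise below \<open>l0 * \<phi>0 + \<Psi> s0\<close>. Monotonicity and affinity of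
      \<open>I\<close> then reverse the strict inequality just obtained.\<close>
    moreover have "I \<Phi> \<le> I (\<lambda>s. l0 * \<phi>0 s + \<Psi> s0)"
      using s0 by (intro mono \<Phi> simp_fun_comp[OF Sig \<phi>0]) (auto simp: \<Psi>_def algebra_simps)
    ultimately show False using aff[OF \<phi>0 l0, of "\<Psi> s0"] by simp
  qed
  then obtain p where p: "p \<in> fa_probs Sig" "\<And>\<phi>. simp_fun Sig \<phi> \<Longrightarrow> c \<phi> \<le> sint p \<phi>" by auto
  have "I \<phi> \<le> sint p \<phi>" if "simp_fun Sig \<phi>" for \<phi>
    using p(2)[OF that] Im by (auto simp: c_def split: if_splits)
  moreover have "- I \<phi>0 \<le> - sint p \<phi>0"
    using p(2)[OF m] sint_affine[OF Sig p(1) \<phi>0, of "-1" 0] by (simp add: c_def \<phi>m_def)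
  ultimately show ?thesis using \<phi>0 by (intro that[OF p(1)]) (auto intro: antisym)
qed

section \<open>Minimal and maximal integrals over a set of priors\<close>

text \<open>Stated on real profiles instead of acts, so that negation, scaling and shifts are
  available.\<close>

definition minf :: "('a set \<Rightarrow> real) set \<Rightarrow> ('a \<Rightarrow> real) \<Rightarrow> real" where
  "minf C \<phi> = Inf ((\<lambda>p. sint p \<phi>) ` C)"

definition maxf :: "('a set \<Rightarrow> real) set \<Rightarrow> ('a \<Rightarrow> real) \<Rightarrow> real" where
  "maxf C \<phi> = Sup ((\<lambda>p. sint p \<phi>) ` C)"

lemma minEU_eq: "minEU C u f = minf C (\<lambda>s. u (f s))"
  by (simp add: minEU_def minf_def o_def)

lemma maxEU_eq: "maxEU C u f = maxf C (\<lambda>s. u (f s))"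
  by (simp add: maxEU_def maxf_def o_def)

locale priors =
  fixes Sig :: "'a set set" and C :: "('a set \<Rightarrow> real) set"
  assumes Sig: "algebra UNIV Sig" and sub: "C \<subseteq> fa_probs Sig" and comp: "compact C" and ne: "C \<noteq> {}"
begin

lemma minf_attained: "\<exists>p\<in>C. minf C \<phi> = sint p \<phi> \<and> (\<forall>q\<in>C. minf C \<phi> \<le> sint q \<phi>)"
proof -
  obtain p where "p \<in> C" "\<forall>q\<in>C. sint p \<phi> \<le> sint q \<phi>"
    using continuous_attains_inf[OF comp ne continuous_on_sint] by blast
  moreover from this have "minf C \<phi> = sint p \<phi>"
    unfolding minf_def by (intro cInf_eq_minimum) auto
  ultimately show ?thesis by metis
qed

lemma minf_le: "p \<in> C \<Longrightarrow> minf C \<phi> \<le> sint p \<phi>"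
  using minf_attained by metis

lemma le_minf_iff: "k \<le> minf C \<phi> \<longleftrightarrow> (\<forall>p\<in>C. k \<le> sint p \<phi>)"
proof -
  obtain p where "p \<in> C" "minf C \<phi> = sint p \<phi>" "\<forall>q\<in>C. minf C \<phi> \<le> sint q \<phi>"
    using minf_attained[of \<phi>] by blast
  then show ?thesis by force
qed

text \<open>Strictness survives because the infimum over a compact set is attained.\<close>

lemma less_minf_iff: "k < minf C \<phi> \<longleftrightarrow> (\<forall>p\<in>C. k < sint p \<phi>)"
proof -
  obtain p where "p \<in> C" "minf C \<phi> = sint p \<phi>" "\<forall>q\<in>C. minf C \<phi> \<le> sint q \<phi>"
    using minf_attained[of \<phi>] by blast
  then show ?thesis by force
qed

lemma sint_eqs:
  assumes "p \<in> C" and "simp_fun Sig \<phi>"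
  shows "sint p (\<lambda>s. a * \<phi> s + b) = a * sint p \<phi> + b"
  using assms sub sint_affine[OF Sig] by blast

text \<open>Duality by negation; it reduces facts about maxima to facts about minima.\<close>

lemma maxf_eq:
  assumes \<phi>: "simp_fun Sig \<phi>"
  shows "maxf C \<phi> = - minf C (\<lambda>s. - \<phi> s)"
proof -
  have neg: "sint p (\<lambda>s. - \<phi> s) = - sint p \<phi>" if "p \<in> C" for p
    using sint_eqs[OF that \<phi>, of "-1" 0] by simp
  obtain p where p: "p \<in> C" "minf C (\<lambda>s. - \<phi> s) = sint p (\<lambda>s. - \<phi> s)"
    "\<forall>q\<in>C. minf C (\<lambda>s. - \<phi> s) \<le> sint q (\<lambda>s. - \<phi> s)"
    using minf_attained by blast
  then have "maxf C \<phi> = sint p \<phi>" unfolding maxf_def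
    using neg by (intro cSup_eq_maximum) auto
  then show ?thesis using p neg by simp
qed

lemma minf_affine:
  assumes \<phi>: "simp_fun Sig \<phi>" and a: "0 \<le> a"
  shows "minf C (\<lambda>s. a * \<phi> s + b) = a * minf C \<phi> + b"
proof (rule antisym)
  obtain p where "p \<in> C" "minf C \<phi> = sint p \<phi>" using minf_attained by blast
  then show "minf C (\<lambda>s. a * \<phi> s + b) \<le> a * minf C \<phi> + b"
    using minf_le[of p "\<lambda>s. a * \<phi> s + b"] sint_eqs[OF _ \<phi>, of p a b] by simp
  show "a * minf C \<phi> + b \<le> minf C (\<lambda>s. a * \<phi> s + b)"
    unfolding le_minf_iff using minf_le sint_eqs[OF _ \<phi>] by (simp add: a mult_left_mono)
qed

lemma maxf_affine:
  assumes \<phi>: "simp_fun Sig \<phi>" and a: "0 \<le> a"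
  shows "maxf C (\<lambda>s. a * \<phi> s + b) = a * maxf C \<phi> + b"
  using minf_affine[OF simp_fun_comp[OF Sig \<phi>, of uminus] a, of "- b"]
    maxf_eq[OF \<phi>] maxf_eq[OF simp_fun_comp[OF Sig \<phi>, of "\<lambda>x. a * x + b"]]
  by simp

lemma minf_mono:
  assumes "simp_fun Sig \<phi>" "simp_fun Sig \<psi>" "\<And>s. \<phi> s \<le> \<psi> s"
  shows "minf C \<phi> \<le> minf C \<psi>"
  unfolding le_minf_iff
proof
  fix p assume p: "p \<in> C"
  then have "p \<in> fa_probs Sig" using sub by auto
  from sint_mono[OF Sig this assms] minf_le[OF p, of \<phi>] show "minf C \<phi> \<le> sint p \<psi>" by simp
qed

lemma maxf_mono:
  assumes "simp_fun Sig \<phi>" "simp_fun Sig \<psi>" "\<And>s. \<phi> s \<le> \<psi> s"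
  shows "maxf C \<phi> \<le> maxf C \<psi>"
  using minf_mono[OF simp_fun_comp[OF Sig assms(2), of uminus] simp_fun_comp[OF Sig assms(1), of uminus]]
    assms maxf_eq by simp

lemma minf_superadd:
  assumes "simp_fun Sig \<phi>" "simp_fun Sig \<psi>" "0 \<le> a" "0 \<le> b"
  shows "a * minf C \<phi> + b * minf C \<psi> \<le> minf C (\<lambda>s. a * \<phi> s + b * \<psi> s)"
  unfolding le_minf_iff
proof
  fix p assume p: "p \<in> C"
  show "a * minf C \<phi> + b * minf C \<psi> \<le> sint p (\<lambda>s. a * \<phi> s + b * \<psi> s)"
    using sint_lin[OF Sig _ assms(1,2), of p a b] sub p minf_le[OF p, of \<phi>] minf_le[OF p, of \<psi>] assms(3,4)
    by (auto intro!: add_mono mult_left_mono)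
qed

lemma maxf_subadd:
  assumes "simp_fun Sig \<phi>" "simp_fun Sig \<psi>" "0 \<le> a" "0 \<le> b"
  shows "maxf C (\<lambda>s. a * \<phi> s + b * \<psi> s) \<le> a * maxf C \<phi> + b * maxf C \<psi>"
  using minf_superadd[OF simp_fun_comp[OF Sig assms(1), of uminus] simp_fun_comp[OF Sig assms(2), of uminus]
      assms(3,4)] assms maxf_eq simp_fun_comp2[OF Sig, of \<phi> \<psi> "\<lambda>x y. a * x + b * y"] by simp

lemma minf_const: "minf C (\<lambda>s. c) = c"
proof -
  obtain p where "p \<in> C" "minf C (\<lambda>s. c) = sint p (\<lambda>s. c)" using minf_attained by blast
  then show ?thesis using sint_const[of p Sig c] sub by auto
qed

lemma maxf_const: "maxf C (\<lambda>s. c) = c"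
  using minf_const[of "- c"] maxf_eq[OF simp_fun_const[OF Sig]] by simp

end

section \<open>Hope-and-prepare representations\<close>

text \<open>The parameter runs over [-1, 1] with midpoint 0, so that reflecting a profile is
  negating it; with utilities -1 at \<open>a\<close> and 1 at \<open>b\<close> the parameter is the
  utility.\<close>

definition seg :: "'b::real_vector \<Rightarrow> 'b \<Rightarrow> real \<Rightarrow> 'b" where
  "seg a b t = ((1 + t) / 2) *\<^sub>R b + (1 - (1 + t) / 2) *\<^sub>R a"

lemma seg_in:
  assumes "convex X" "a \<in> X" "b \<in> X" "\<bar>t\<bar> \<le> 1"
  shows "seg a b t \<in> X"
  using convexD_alt[OF assms(1-3), of "(1 + t) / 2"] assms(4) by (auto simp: seg_def add.commute)

lemma affine_on_seg:
  assumes "affine_on X u" "a \<in> X" "b \<in> X" "\<bar>t\<bar> \<le> 1"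
  shows "u (seg a b t) = ((1 + t) / 2) * u b + (1 - (1 + t) / 2) * u a"
proof -
  have "0 \<le> (1 + t) / 2" "(1 + t) / 2 \<le> 1" using assms(4) by auto
  then show ?thesis using assms(1-3) unfolding affine_on_def seg_def by blast
qed

lemma affine_on_mixa:
  assumes "affine_on X u" "f s \<in> X" "g s \<in> X" "0 \<le> \<alpha>" "\<alpha> \<le> 1"
  shows "u (mixa \<alpha> f g s) = \<alpha> * u (f s) + (1 - \<alpha>) * u (g s)"
  using assms by (auto simp: affine_on_def mixa_def)

lemma cact_in_acts: "algebra UNIV Sig \<Longrightarrow> x \<in> X \<Longrightarrow> cact x \<in> simple_acts Sig X"
  by (simp add: simple_acts_iff cact_def simp_fun_const)

lemma mixa_in_acts:
  assumes "algebra UNIV Sig" "convex X" "f \<in> simple_acts Sig X" "g \<in> simple_acts Sig X"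
    "0 \<le> \<alpha>" "\<alpha> \<le> 1"
  shows "mixa \<alpha> f g \<in> simple_acts Sig X"
proof -
  have "simp_fun Sig (mixa \<alpha> f g)" unfolding mixa_def
    using simp_fun_comp2[OF assms(1), of f g "\<lambda>x y. \<alpha> *\<^sub>R x + (1 - \<alpha>) *\<^sub>R y"] assms
    by (simp add: simple_acts_iff)
  moreover have "mixa \<alpha> f g s \<in> X" for s
    unfolding mixa_def using assms by (intro convexD) (auto simp: simple_acts_iff)
  ultimately show ?thesis by (simp add: simple_acts_iff)
qed

lemma simp_fun_utility:
  "algebra UNIV Sig \<Longrightarrow> f \<in> simple_acts Sig X \<Longrightarrow> simp_fun Sig (\<lambda>s. u (f s))"
  by (simp add: simp_fun_comp simple_acts_iff)

lemma affine_on_intermediate: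
  assumes X: "convex X" and u: "affine_on X u" and x: "x \<in> X" and y: "y \<in> X"
    and k: "u x \<le> k" "k \<le> u y"
  obtains z where "z \<in> X" "u z = k"
proof (cases "u x = u y")
  case True
  then show ?thesis using that[OF x] k by simp
next
  case False
  define t where "t = (k - u x) / (u y - u x)"
  have t: "0 \<le> t" "t \<le> 1" using False k by (auto simp: t_def divide_simps)
  have "u (t *\<^sub>R y + (1 - t) *\<^sub>R x) = t * u y + (1 - t) * u x"
    using u x y t by (auto simp: affine_on_def)
  also have "\<dots> = u x + t * (u y - u x)" by (simp add: algebra_simps)
  also have "\<dots> = k" using False by (simp add: t_def)
  finally show ?thesis
    using that[of "t *\<^sub>R y + (1 - t) *\<^sub>R x"] convexD_alt[OF X x y t] by (simp add: add.commute)
qed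

text \<open>A bounded profile fits into a nondegenerate segment of outcomes once it is scaled down.
  The act \<open>g\<close> is the mirror image of \<open>f\<close> in the midpoint, which prepares
  complementary pairs.\<close>

lemma acts_realise_profile:
  assumes Sig: "algebra UNIV Sig" and X: "convex X" and u: "affine_on X u" "nonconst_on X u"
    and \<phi>: "simp_fun Sig \<phi>"
  obtains x B f g where "x \<in> X" "0 < B" "f \<in> simple_acts Sig X" "g \<in> simple_acts Sig X"
    "\<And>s. u (f s) = B * \<phi> s + u x" "\<And>s. u (g s) = - B * \<phi> s + u x"
proof -
  obtain a b where ab: "a \<in> X" "b \<in> X" "u a < u b"
    using u(2) unfolding nonconst_on_def by (metis neq_iff)
  obtain M where M: "M > 0" "\<And>s. \<bar>\<phi> s\<bar> \<le> M" using simp_fun_bounded[OF \<phi>] by blast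
  \<comment> \<open>The sign \<open>\<sigma>\<close> selects the act or its mirror image; division
    by the bound \<open>M\<close> keeps the parameter in [-1, 1].\<close>
  define f where "f \<sigma> s = seg a b (\<sigma> * \<phi> s / M)" for \<sigma> s
  have b1: "\<bar>\<sigma> * \<phi> s / M\<bar> \<le> 1" if "\<bar>\<sigma>\<bar> = 1" for \<sigma> s
    using M that by (simp add: abs_mult divide_simps)
  have fin: "f \<sigma> \<in> simple_acts Sig X" if "\<bar>\<sigma>\<bar> = 1" for \<sigma>
    using seg_in[OF X ab(1,2) b1[OF that]] simp_fun_comp[OF Sig \<phi>, of "\<lambda>x. seg a b (\<sigma> * x / M)"]
    by (simp add: simple_acts_iff f_def[abs_def])
  have uf: "u (f \<sigma> s) = (u b - u a) / (2 * M) * (\<sigma> * \<phi> s) + u (seg a b 0)" if "\<bar>\<sigma>\<bar> = 1" for \<sigma> s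
    using M(1) unfolding f_def affine_on_seg[OF u(1) ab(1,2) b1[OF that]]
      affine_on_seg[OF u(1) ab(1,2), of 0, simplified] by (simp add: field_simps)
  show ?thesis
  proof (rule that)
    show "seg a b 0 \<in> X" by (rule seg_in[OF X ab(1,2)]) simp
    show "0 < (u b - u a) / (2 * M)" using ab M by simp
    show "f 1 \<in> simple_acts Sig X" "f (-1) \<in> simple_acts Sig X" by (auto intro: fin)
    show "u (f 1 s) = (u b - u a) / (2 * M) * \<phi> s + u (seg a b 0)" for s
      using uf[of 1 s] by simp
    show "u (f (-1) s) = - ((u b - u a) / (2 * M)) * \<phi> s + u (seg a b 0)" for s
      using uf[of "-1" s] by simp
  qed
qed

section \<open>Axioms A8 and A9 as inclusions between the sets of priors\<close>

locale hope_prepare =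
  fixes Sig :: "'a set set" and X :: "'b::real_vector set" and R u C D
  assumes Sig: "algebra UNIV Sig" and X: "convex X" and rep: "hp_rep Sig X R u C D"
begin

lemma u: "affine_on X u" "nonconst_on X u"
  and CD: "convex_meas C" "convex_meas D" "C \<inter> D \<noteq> {}"
  using rep by (auto simp: hp_rep_def)

sublocale C: priors Sig C
  using rep Sig by (intro priors.intro) (auto simp: hp_rep_def)

sublocale D: priors Sig D
  using rep Sig by (intro priors.intro) (auto simp: hp_rep_def)

abbreviation acts where "acts \<equiv> simple_acts Sig X"

lemma simp_u: "f \<in> acts \<Longrightarrow> simp_fun Sig (\<lambda>s. u (f s))"
  by (rule simp_fun_utility[OF Sig])

lemma R_iff:
  "f \<in> acts \<Longrightarrow> g \<in> acts \<Longrightarrow> R f g \<longleftrightarrow>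
    minf C (\<lambda>s. u (g s)) < minf C (\<lambda>s. u (f s)) \<and> maxf D (\<lambda>s. u (g s)) < maxf D (\<lambda>s. u (f s))"
  using rep by (auto simp: hp_rep_def minEU_eq maxEU_eq)

text \<open>The integral against a common prior lies between the two values; this is where
  \<open>C \<inter> D \<noteq> {}\<close> enters.\<close>

lemma min_le_max:
  assumes \<phi>: "simp_fun Sig \<phi>"
  shows "minf C \<phi> \<le> maxf D \<phi>"
proof -
  obtain q where q: "q \<in> C" "q \<in> D" using CD by auto
  have "sint q (\<lambda>s. - \<phi> s) = - sint q \<phi>" using D.sint_eqs[OF q(2) \<phi>, of "-1" 0] by simp
  then show ?thesis using C.minf_le[OF q(1), of \<phi>] D.minf_le[OF q(2), of "\<lambda>s. - \<phi> s"] D.maxf_eq[OF \<phi>] by simp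
qed

text \<open>Acts of constant utility behave like constants; they need not be constant acts.\<close>

lemma R_const_iff:
  assumes f: "f \<in> acts" and h: "h \<in> acts" "\<And>s. u (h s) = k"
  shows "R f h \<longleftrightarrow> k < minf C (\<lambda>s. u (f s))" "R h f \<longleftrightarrow> maxf D (\<lambda>s. u (f s)) < k"
  using R_iff[OF f h(1)] R_iff[OF h(1) f] min_le_max[OF simp_u[OF f]]
  by (auto simp: h(2) C.minf_const D.maxf_const)

lemma R_cact_iff:
  assumes "f \<in> acts" and "x \<in> X"
  shows "R f (cact x) \<longleftrightarrow> u x < minf C (\<lambda>s. u (f s))" "R (cact x) f \<longleftrightarrow> maxf D (\<lambda>s. u (f s)) < u x"
  using R_const_iff[OF assms(1) cact_in_acts[OF Sig assms(2)], of "u x"] by (auto simp: cact_def)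

lemma R_cact_cact:
  assumes "y \<in> X" and "x \<in> X"
  shows "R (cact y) (cact x) \<longleftrightarrow> u x < u y"
  using R_cact_iff[OF cact_in_acts[OF Sig assms(1)] assms(2)] C.minf_const
  by (simp add: cact_def)

text \<open>On constants the preference is the strict order of utilities, so incomparability is
  equality of utility. The number \<open>k\<close> is the constant utility of the half
  mixture.\<close>

lemma complementary_iff:
  assumes f: "f \<in> acts" and g: "g \<in> acts"
  shows "complementary R f g \<longleftrightarrow> (\<exists>k. \<forall>s. u (g s) = 2 * k - u (f s))"
proof -
  have e: "(1/2) *\<^sub>R f s + (1/2) *\<^sub>R g s = mixa (1/2) f g s" for s by (simp add: mixa_def)
  have um: "u (mixa (1/2) f g s) = (u (f s) + u (g s)) / 2" for s
    using affine_on_mixa[OF u(1), of f s g "1/2"] f g by (simp add: simple_acts_iff)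
  have mX: "mixa (1/2) f g s \<in> X" for s
    using mixa_in_acts[OF Sig X f g, of "1/2"] by (simp add: simple_acts_iff)
  have "complementary R f g \<longleftrightarrow> (\<forall>s s'. u (f s) + u (g s) = u (f s') + u (g s'))"
  proof -
    have "incomp R (cact (mixa (1/2) f g s)) (cact (mixa (1/2) f g s')) \<longleftrightarrow>
        u (f s) + u (g s) = u (f s') + u (g s')" for s s'
      unfolding incomp_def R_cact_cact[OF mX mX] um by (simp add: divide_less_cancel) linarith
    then show ?thesis by (simp only: complementary_def e)
  qed
  also have "\<dots> \<longleftrightarrow> (\<exists>k. \<forall>s. u (g s) = 2 * k - u (f s))"
  proof
    assume *: "\<forall>s s'. u (f s) + u (g s) = u (f s') + u (g s')"
    show "\<exists>k. \<forall>s. u (g s) = 2 * k - u (f s)"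
    proof (intro exI allI)
      fix s
      \<comment> \<open>An arbitrary reference state, \<open>undefined\<close>, supplies the value
        of \<open>k\<close>.\<close>
      show "u (g s) = 2 * ((u (f undefined) + u (g undefined)) / 2) - u (f s)"
        using *[rule_format, of s undefined] by (simp add: field_simps)
    qed
  next
    assume "\<exists>k. \<forall>s. u (g s) = 2 * k - u (f s)"
    then show "\<forall>s s'. u (f s) + u (g s) = u (f s') + u (g s')" by auto
  qed
  finally show ?thesis .
qed

text \<open>The half mixture has constant utility \<open>k\<close>, and reflection in
  \<open>k\<close> turns the maximum of \<open>g\<close> over \<open>D\<close> into the minimum of
  \<open>f\<close> over \<open>D\<close>. Both comparisons thus become conditions on the single
  profile of \<open>f\<close>.\<close>

lemma R_complementary:
  assumes f: "f \<in> acts" and g: "g \<in> acts" and k: "\<And>s. u (g s) = 2 * k - u (f s)"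
  shows "R f (mixa (1/2) f g) \<longleftrightarrow> k < minf C (\<lambda>s. u (f s))"
    and "R (mixa (1/2) f g) g \<longleftrightarrow> k < minf D (\<lambda>s. u (f s))"
proof -
  have m: "mixa (1/2) f g \<in> acts" using mixa_in_acts[OF Sig X f g, of "1/2"] by simp
  have um: "u (mixa (1/2) f g s) = k" for s
    using affine_on_mixa[OF u(1), of f s g "1/2"] f g k by (simp add: simple_acts_iff field_simps)
  show "R f (mixa (1/2) f g) \<longleftrightarrow> k < minf C (\<lambda>s. u (f s))" by (rule R_const_iff[OF f m um])
  have "maxf D (\<lambda>s. u (g s)) = 2 * k - minf D (\<lambda>s. u (f s))"
    using D.minf_affine[OF simp_u[OF f], of 1 "- 2 * k"] D.maxf_eq[OF simp_u[OF g]] by (simp add: k)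
  then show "R (mixa (1/2) f g) g \<longleftrightarrow> k < minf D (\<lambda>s. u (f s))"
    using R_const_iff(2)[OF g m um] by auto
qed

lemma complementary_realise:
  assumes \<phi>: "simp_fun Sig \<phi>"
  obtains f g where "f \<in> acts" "g \<in> acts" "complementary R f g"
    "R f (mixa (1/2) f g) \<longleftrightarrow> 0 < minf C \<phi>" "R (mixa (1/2) f g) g \<longleftrightarrow> 0 < minf D \<phi>"
proof -
  obtain x B f g where fg: "0 < B" "f \<in> acts" "g \<in> acts"
    "\<And>s. u (f s) = B * \<phi> s + u x" "\<And>s. u (g s) = - B * \<phi> s + u x"
    using acts_realise_profile[OF Sig X u \<phi>] by metis
  have k: "u (g s) = 2 * u x - u (f s)" for s using fg by simp
  show ?thesis
    using R_complementary[OF fg(2,3) k] complementary_iff[OF fg(2,3)] k fg(1)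
      C.minf_affine[OF \<phi>, of B "u x"] D.minf_affine[OF \<phi>, of B "u x"]
    by (intro that[OF fg(2,3)]) (auto simp: fg(4) zero_less_mult_iff)
qed

text \<open>On complementary pairs A8 says that a positive minimum over \<open>C\<close> forces a
  positive minimum over \<open>D\<close>. A prior of \<open>D\<close> outside \<open>C\<close> is
  separated from \<open>C\<close> by a profile that is positive on \<open>C\<close> and 0 at that
  prior, which violates this. A9 is the same with the two sets exchanged.\<close>

lemma A8_iff: "A8 Sig X R \<longleftrightarrow> D \<subseteq> C"
proof
  assume A8: "A8 Sig X R"
  show "D \<subseteq> C"
  proof (rule ccontr)
    assume "\<not> D \<subseteq> C"
    then obtain p where p: "p \<in> D" "p \<notin> C" by auto
    then have "p \<in> fa_probs Sig" using D.sub by auto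
    then obtain \<phi> where \<phi>: "simp_fun Sig \<phi>" "sint p \<phi> = 0" "\<And>q. q \<in> C \<Longrightarrow> 0 < sint q \<phi>"
      using strict_separation[OF Sig C.sub C.comp CD(1) _ p(2)] by metis
    obtain f g where fg: "f \<in> acts" "g \<in> acts" "complementary R f g"
      "R f (mixa (1/2) f g) \<longleftrightarrow> 0 < minf C \<phi>" "R (mixa (1/2) f g) g \<longleftrightarrow> 0 < minf D \<phi>"
      by (rule complementary_realise[OF \<phi>(1)])
    have "0 < minf C \<phi>" using \<phi> by (simp add: C.less_minf_iff)
    then have "0 < minf D \<phi>" using A8 fg by (auto simp: A8_def)
    then show False using p \<phi> by (auto simp: D.less_minf_iff)
  qed
next
  assume "D \<subseteq> C"
  then have "k < minf C \<phi> \<Longrightarrow> k < minf D \<phi>" for k \<phi>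
    by (auto simp: C.less_minf_iff D.less_minf_iff)
  then show "A8 Sig X R"
    by (auto simp: A8_def complementary_iff R_complementary)
qed

lemma A9_iff: "A9 Sig X R \<longleftrightarrow> C \<subseteq> D"
proof
  assume A9: "A9 Sig X R"
  show "C \<subseteq> D"
  proof (rule ccontr)
    assume "\<not> C \<subseteq> D"
    then obtain p where p: "p \<in> C" "p \<notin> D" by auto
    then have "p \<in> fa_probs Sig" using C.sub by auto
    then obtain \<phi> where \<phi>: "simp_fun Sig \<phi>" "sint p \<phi> = 0" "\<And>q. q \<in> D \<Longrightarrow> 0 < sint q \<phi>"
      using strict_separation[OF Sig D.sub D.comp CD(2) _ p(2)] by metis
    obtain f g where fg: "f \<in> acts" "g \<in> acts" "complementary R f g"
      "R f (mixa (1/2) f g) \<longleftrightarrow> 0 < minf C \<phi>" "R (mixa (1/2) f g) g \<longleftrightarrow> 0 < minf D \<phi>"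
      by (rule complementary_realise[OF \<phi>(1)])
    have "0 < minf D \<phi>" using \<phi> by (simp add: D.less_minf_iff)
    then have "0 < minf C \<phi>" using A9 fg by (auto simp: A9_def)
    then show False using p \<phi> by (auto simp: C.less_minf_iff)
  qed
next
  assume "C \<subseteq> D"
  then have "k < minf D \<phi> \<Longrightarrow> k < minf C \<phi>" for k \<phi>
    by (auto simp: C.less_minf_iff D.less_minf_iff)
  then show "A9 Sig X R"
    by (auto simp: A9_def complementary_iff R_complementary)
qed

end

section \<open>Necessity of A1 to A7\<close>

context priors begin

text \<open>Monotonicity and translation invariance alone give Lipschitz constant 1 in the supremum
  norm; continuity along mixtures, needed for A2, follows.\<close>

lemma minf_lipschitz:
  assumes "simp_fun Sig \<phi>" "simp_fun Sig \<psi>" "\<And>s. \<bar>\<phi> s - \<psi> s\<bar> \<le> d"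
  shows "\<bar>minf C \<phi> - minf C \<psi>\<bar> \<le> d"
proof -
  have "minf C \<phi>1 - minf C \<phi>2 \<le> d"
    if "simp_fun Sig \<phi>1" "simp_fun Sig \<phi>2" "\<And>s. \<bar>\<phi>1 s - \<phi>2 s\<bar> \<le> d" for \<phi>1 \<phi>2
  proof -
    have "minf C \<phi>1 \<le> minf C (\<lambda>s. 1 * \<phi>2 s + d)"
    proof (intro minf_mono that(1) simp_fun_comp[OF Sig that(2)])
      show "\<phi>1 s \<le> 1 * \<phi>2 s + d" for s using that(3)[of s] by linarith
    qed
    then show ?thesis using minf_affine[OF that(2), of 1 d] by simp
  qed
  from this[of \<phi> \<psi>] this[of \<psi> \<phi>] show ?thesis using assms by (simp add: abs_minus_commute abs_le_iff)
qed

lemma continuous_minf_mix: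
  assumes \<phi>: "simp_fun Sig \<phi>" and \<psi>: "simp_fun Sig \<psi>"
  shows "continuous_on S (\<lambda>\<alpha>. minf C (\<lambda>s. \<alpha> * \<phi> s + (1 - \<alpha>) * \<psi> s))"
proof -
  obtain M where M: "M > 0" "\<And>s. \<bar>\<phi> s - \<psi> s\<bar> \<le> M"
    using simp_fun_bounded[OF simp_fun_comp2[OF Sig \<phi> \<psi>, of "(-)"]] by blast
  have "M-lipschitz_on S (\<lambda>\<alpha>. minf C (\<lambda>s. \<alpha> * \<phi> s + (1 - \<alpha>) * \<psi> s))"
  proof (rule lipschitz_onI)
    fix \<alpha> \<beta> :: real
    have "\<bar>(\<alpha> * \<phi> s + (1 - \<alpha>) * \<psi> s) - (\<beta> * \<phi> s + (1 - \<beta>) * \<psi> s)\<bar> \<le> M * \<bar>\<alpha> - \<beta>\<bar>" for s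
    proof -
      have "(\<alpha> * \<phi> s + (1 - \<alpha>) * \<psi> s) - (\<beta> * \<phi> s + (1 - \<beta>) * \<psi> s) = (\<phi> s - \<psi> s) * (\<alpha> - \<beta>)"
        by (simp add: algebra_simps)
      then show ?thesis using M(2)[of s] by (simp add: abs_mult mult_right_mono)
    qed
    then show "dist (minf C (\<lambda>s. \<alpha> * \<phi> s + (1 - \<alpha>) * \<psi> s)) (minf C (\<lambda>s. \<beta> * \<phi> s + (1 - \<beta>) * \<psi> s))
        \<le> M * dist \<alpha> \<beta>"
      unfolding dist_real_def by (intro minf_lipschitz simp_fun_comp2[OF Sig \<phi> \<psi>])
  qed (use M in simp)
  then show ?thesis by (rule lipschitz_on_continuous_on)
qed

lemma continuous_maxf_mix:
  assumes \<phi>: "simp_fun Sig \<phi>" and \<psi>: "simp_fun Sig \<psi>"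
  shows "continuous_on S (\<lambda>\<alpha>. maxf C (\<lambda>s. \<alpha> * \<phi> s + (1 - \<alpha>) * \<psi> s))"
proof -
  have "maxf C (\<lambda>s. \<alpha> * \<phi> s + (1 - \<alpha>) * \<psi> s) = - minf C (\<lambda>s. \<alpha> * (- \<phi> s) + (1 - \<alpha>) * (- \<psi> s))" for \<alpha>
  proof -
    have "(\<lambda>s. \<alpha> * (- \<phi> s) + (1 - \<alpha>) * (- \<psi> s)) = (\<lambda>s. - (\<alpha> * \<phi> s + (1 - \<alpha>) * \<psi> s))"
      by (simp add: fun_eq_iff)
    then show ?thesis
      using maxf_eq[OF simp_fun_comp2[OF Sig \<phi> \<psi>, of "\<lambda>x y. \<alpha> * x + (1 - \<alpha>) * y"]] by simp
  qed
  then show ?thesis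
    using continuous_minf_mix[OF simp_fun_comp[OF Sig \<phi>, of uminus] simp_fun_comp[OF Sig \<psi>, of uminus]]
    by (simp add: continuous_on_minus)
qed

text \<open>With \<open>affine_on_intermediate\<close> this yields an outcome whose utility is the
  minimum, that is, a certainty equivalent.\<close>

lemma minf_between:
  assumes \<phi>: "simp_fun Sig \<phi>"
  shows "\<exists>s s'. \<phi> s \<le> minf C \<phi> \<and> minf C \<phi> \<le> \<phi> s'"
proof -
  have fin: "finite (range \<phi>)" using \<phi> by (simp add: simp_fun_def)
  obtain s where s: "\<phi> s = Min (range \<phi>)" using Min_in[OF fin] by fastforce
  obtain s' where s': "\<phi> s' = Max (range \<phi>)" using Max_in[OF fin] by fastforce
  have "minf C (\<lambda>_. \<phi> s) \<le> minf C \<phi>" "minf C \<phi> \<le> minf C (\<lambda>_. \<phi> s')"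
    using fin s s' by (auto intro!: minf_mono \<phi> simp_fun_const Sig)
  then show ?thesis by (auto simp: minf_const)
qed

lemma maxf_between:
  assumes \<phi>: "simp_fun Sig \<phi>"
  shows "\<exists>s s'. \<phi> s \<le> maxf C \<phi> \<and> maxf C \<phi> \<le> \<phi> s'"
  using minf_between[OF simp_fun_comp[OF Sig \<phi>, of uminus]] maxf_eq[OF \<phi>] by (metis minus_le_iff le_minus_iff)

end

context hope_prepare begin

lemma u_mixa:
  assumes "f \<in> acts" "g \<in> acts" "0 \<le> \<alpha>" "\<alpha> \<le> 1"
  shows "u (mixa \<alpha> f g s) = \<alpha> * u (f s) + (1 - \<alpha>) * u (g s)"
  using assms by (intro affine_on_mixa[OF u(1)]) (auto simp: simple_acts_iff)

lemma A1: "A1 Sig X R"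
proof -
  obtain x y where "x \<in> X" "y \<in> X" "u x < u y"
    using u(2) unfolding nonconst_on_def by (metis neq_iff)
  then have "\<exists>x\<in>X. \<exists>y\<in>X. R (cact x) (cact y)" using R_cact_cact by blast
  then show ?thesis
    unfolding A1_def by (intro conjI) (auto simp: R_iff R_cact_cact)
qed

lemma A2: "A2 Sig X R"
  unfolding A2_def
proof (intro ballI)
  fix f g h assume fgh: "f \<in> acts" "g \<in> acts" "h \<in> acts"
  define I J where "I \<alpha> = minf C (\<lambda>s. \<alpha> * u (f s) + (1 - \<alpha>) * u (g s))"
    and "J \<alpha> = maxf D (\<lambda>s. \<alpha> * u (f s) + (1 - \<alpha>) * u (g s))" for \<alpha>
  have co: "continuous_on {0..1} I" "continuous_on {0..1} J"
    unfolding I_def[abs_def] J_def[abs_def]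
    using fgh by (auto intro!: C.continuous_minf_mix D.continuous_maxf_mix simp_u)
  have e: "{\<alpha>\<in>{0..1}. R (mixa \<alpha> f g) h} =
      ({0..1} \<inter> I -` {minf C (\<lambda>s. u (h s)) <..}) \<inter> ({0..1} \<inter> J -` {maxf D (\<lambda>s. u (h s)) <..})"
    "{\<alpha>\<in>{0..1}. R h (mixa \<alpha> f g)} =
      ({0..1} \<inter> I -` {..< minf C (\<lambda>s. u (h s))}) \<inter> ({0..1} \<inter> J -` {..< maxf D (\<lambda>s. u (h s))})"
    using fgh by (auto simp: R_iff mixa_in_acts[OF Sig X] u_mixa I_def J_def)
  show "openin (top_of_set {0..1}) {\<alpha>\<in>{0..1}. R (mixa \<alpha> f g) h} \<and>
        openin (top_of_set {0..1}) {\<alpha>\<in>{0..1}. R h (mixa \<alpha> f g)}"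
    unfolding e by (intro conjI openin_Int continuous_openin_preimage_gen co) auto
qed

lemma A3: "A3 Sig X R"
  unfolding A3_def
proof (intro ballI)
  fix f g x and \<alpha> :: real assume *: "f \<in> acts" "g \<in> acts" "x \<in> X" "\<alpha> \<in> {0<..<1}"
  have c: "cact x \<in> acts" by (rule cact_in_acts[OF Sig *(3)])
  have "(\<lambda>s. u (mixa \<alpha> h (cact x) s)) = (\<lambda>s. \<alpha> * u (h s) + (1 - \<alpha>) * u x)" if "h \<in> acts" for h
    using u_mixa[OF that c, of \<alpha>] * by (simp add: cact_def)
  then show "R f g \<longleftrightarrow> R (mixa \<alpha> f (cact x)) (mixa \<alpha> g (cact x))"
    using * c by (simp add: R_iff mixa_in_acts[OF Sig X] C.minf_affine D.maxf_affine simp_u)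
qed

lemma A4: "A4 Sig X R"
  unfolding A4_def
proof (intro ballI)
  fix f g x and \<alpha> :: real assume *: "x \<in> X" "f \<in> acts" "g \<in> acts" "\<alpha> \<in> {0..1}"
  then have m: "mixa \<alpha> f g \<in> acts" by (intro mixa_in_acts[OF Sig X]) auto
  have um: "(\<lambda>s. u (mixa \<alpha> f g s)) = (\<lambda>s. \<alpha> * u (f s) + (1 - \<alpha>) * u (g s))"
    using u_mixa[OF *(2,3), of \<alpha>] * by auto
  have lt: "\<alpha> * k + (1 - \<alpha>) * k' < c" if "k < c" "k' < c" for k k' c :: real
    using convex_bound_lt[OF that, of \<alpha> "1 - \<alpha>"] *(4) by auto
  have gt: "c < \<alpha> * k + (1 - \<alpha>) * k'" if "c < k" "c < k'" for k k' c :: real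
    using lt[of "- k" "- c" "- k'"] that by simp
  have I: "\<alpha> * minf C (\<lambda>s. u (f s)) + (1 - \<alpha>) * minf C (\<lambda>s. u (g s))
      \<le> minf C (\<lambda>s. \<alpha> * u (f s) + (1 - \<alpha>) * u (g s))"
    using * by (intro C.minf_superadd simp_u) auto
  have J: "maxf D (\<lambda>s. \<alpha> * u (f s) + (1 - \<alpha>) * u (g s))
      \<le> \<alpha> * maxf D (\<lambda>s. u (f s)) + (1 - \<alpha>) * maxf D (\<lambda>s. u (g s))"
    using * by (intro D.maxf_subadd simp_u) auto
  show "(R f (cact x) \<and> R g (cact x) \<longrightarrow> R (mixa \<alpha> f g) (cact x)) \<and>
        (R (cact x) f \<and> R (cact x) g \<longrightarrow> R (cact x) (mixa \<alpha> f g))"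
    unfolding R_cact_iff[OF m *(1)] R_cact_iff[OF *(2) *(1)] R_cact_iff[OF *(3) *(1)] um
    using I J lt gt by (meson less_le_trans le_less_trans)
qed

lemma A5: "A5 Sig X R"
  unfolding A5_def
proof (intro ballI impI)
  fix f g assume *: "f \<in> acts" "g \<in> acts" "\<forall>s. R (cact (f s)) (cact (g s))"
  then have X': "f s \<in> X" "g s \<in> X" for s by (auto simp: simple_acts_iff)
  \<comment> \<open>Finitely many values turn pointwise strict dominance into a uniform margin,
    which passes to the minimum and the maximum.\<close>
  define \<delta> where "\<delta> = Min (range (\<lambda>s. u (f s) - u (g s)))"
  have "simp_fun Sig (\<lambda>s. u (f s) - u (g s))"
    using * by (intro simp_fun_comp2[OF Sig, where h = "(-)"] simp_u)
  then have fin: "finite (range (\<lambda>s. u (f s) - u (g s)))" by (simp add: simp_fun_def)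
  have "u (f s) - u (g s) > 0" for s using * X' R_cact_cact by simp
  then have "\<delta> > 0" using fin by (auto simp: \<delta>_def)
  have le: "1 * u (g s) + \<delta> \<le> u (f s)" for s
    using Min_le[OF fin, of "u (f s) - u (g s)"] by (auto simp: \<delta>_def)
  have "minf C (\<lambda>s. 1 * u (g s) + \<delta>) \<le> minf C (\<lambda>s. u (f s))"
    "maxf D (\<lambda>s. 1 * u (g s) + \<delta>) \<le> maxf D (\<lambda>s. u (f s))"
    using * le by (auto intro!: C.minf_mono D.maxf_mono simp_u simp_fun_comp[OF Sig simp_u[OF *(2)], of "\<lambda>x. x + \<delta>"])
  then show "R f g"
    using * \<open>\<delta> > 0\<close> C.minf_affine[OF simp_u[OF *(2)], of 1 \<delta>] D.maxf_affine[OF simp_u[OF *(2)], of 1 \<delta>]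
    by (simp add: R_iff)
qed

lemma incomp_cact_iff:
  assumes "f \<in> acts" and "x \<in> X"
  shows "incomp R f (cact x) \<longleftrightarrow> minf C (\<lambda>s. u (f s)) \<le> u x \<and> u x \<le> maxf D (\<lambda>s. u (f s))"
  using R_cact_iff[OF assms] by (auto simp: incomp_def)

text \<open>The utilities of outcomes incomparable to an act form the interval from its minimum over
  \<open>C\<close> to its maximum over \<open>D\<close>. Testing the endpoints for \<open>f\<close>
  shows that its interval lies inside that of \<open>g\<close>, and nested intervals exclude strict
  preference either way.\<close>

lemma A6: "A6 Sig X R"
  unfolding A6_def
proof (intro ballI impI)
  fix f g assume *: "f \<in> acts" "g \<in> acts" "\<forall>x\<in>X. incomp R f (cact x) \<longrightarrow> incomp R g (cact x)"
  have X': "f s \<in> X" for s using * by (auto simp: simple_acts_iff)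
  obtain x where x: "x \<in> X" "u x = minf C (\<lambda>s. u (f s))"
    using C.minf_between[OF simp_u[OF *(1)]] affine_on_intermediate[OF X u(1) X' X'] by metis
  obtain y where y: "y \<in> X" "u y = maxf D (\<lambda>s. u (f s))"
    using D.maxf_between[OF simp_u[OF *(1)]] affine_on_intermediate[OF X u(1) X' X'] by metis
  have "minf C (\<lambda>s. u (g s)) \<le> u x" "u y \<le> maxf D (\<lambda>s. u (g s))"
    using *(3) x y min_le_max[OF simp_u[OF *(1)]] incomp_cact_iff[OF *(1)] incomp_cact_iff[OF *(2)] by auto
  then show "incomp R f g" using x y * by (auto simp: incomp_def R_iff)
qed

lemma A7: "A7 Sig X R"
  unfolding A7_def by (auto simp: incomp_cact_iff R_cact_iff R_iff)

end

section \<open>Uniqueness of the utility and of the priors\<close>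

text \<open>Collinearity of the three points with coordinates \<open>u\<close> and
  \<open>u'\<close>. The outcome \<open>y\<close> is indifferent to a mixture of \<open>x\<close>
  and \<open>z\<close>; since both utilities induce the same order, \<open>u'\<close> is
  interpolated with the same weight.\<close>

lemma affine_on_determinant:
  assumes X: "convex X" and u: "affine_on X u" and u': "affine_on X u'"
    and ord: "\<And>x y. x \<in> X \<Longrightarrow> y \<in> X \<Longrightarrow> u x < u y \<longleftrightarrow> u' x < u' y"
    and xyz: "x \<in> X" "y \<in> X" "z \<in> X" and le: "u x \<le> u y" "u y \<le> u z"
  shows "(u z - u x) * u' y = (u z - u y) * u' x + (u y - u x) * u' z"
proof (cases "u x = u z")
  case False
  define t where "t = (u y - u x) / (u z - u x)"
  define w where "w = t *\<^sub>R z + (1 - t) *\<^sub>R x"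
  have t: "0 \<le> t" "t \<le> 1" "t * (u z - u x) = u y - u x"
    using False le by (auto simp: t_def divide_simps)
  have w: "w \<in> X" using convexD_alt[OF X xyz(1,3) t(1,2)] by (simp add: w_def add.commute)
  have "u w = t * u z + (1 - t) * u x" "u' w = t * u' z + (1 - t) * u' x"
    using u u' xyz t unfolding w_def affine_on_def by blast+
  moreover from this have "u w = u y" using t by (simp add: algebra_simps)
  then have "u' w = u' y" using ord[of w y] ord[of y w] w xyz by auto
  ultimately have e: "u' y = t * u' z + (1 - t) * u' x" by simp
  have "(u z - u x) * u' y = (t * (u z - u x)) * u' z + ((u z - u x) - t * (u z - u x)) * u' x"
    unfolding e by (simp add: algebra_simps)
  then show ?thesis unfolding t(3) by (simp add: algebra_simps)
qed (use le in auto)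

lemma affine_on_unique:
  assumes X: "convex X" and u: "affine_on X u" "nonconst_on X u" and u': "affine_on X u'"
    and ord: "\<And>x y. x \<in> X \<Longrightarrow> y \<in> X \<Longrightarrow> u x < u y \<longleftrightarrow> u' x < u' y"
  shows "pos_affine_trans X u u'"
proof -
  obtain a b where ab: "a \<in> X" "b \<in> X" "u a < u b"
    using u(2) unfolding nonconst_on_def by (metis neq_iff)
  define k where "k = (u' b - u' a) / (u b - u a)"
  have "k > 0" using ab ord[OF ab(1,2)] by (simp add: k_def)
  moreover have "u' x = k * u x + (u' a - k * u a)" if x: "x \<in> X" for x
  proof -
    note det = affine_on_determinant[OF X u(1) u' ord]
    have "(u b - u a) * (u' x - u' a) = (u' b - u' a) * (u x - u a)"
    proof -
      \<comment> \<open>Collinearity was shown for ordered triples, so the position of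
        \<open>x\<close> relative to \<open>a\<close> and \<open>b\<close> decides how it is
        applied.\<close>
      consider "u x \<le> u a" | "u a \<le> u x" "u x \<le> u b" | "u b \<le> u x" by linarith
      then show ?thesis
      proof cases
        case 1
        then show ?thesis using det[of x a b] ab x by (simp add: algebra_simps)
      next
        case 2
        then show ?thesis using det[of a x b] ab x by (simp add: algebra_simps)
      next
        case 3
        then show ?thesis using det[of a b x] ab x by (simp add: algebra_simps)
      qed
    qed
    then have "u' x - u' a = k * (u x - u a)"
      using ab unfolding k_def times_divide_eq_left by (subst nonzero_eq_divide_eq) (auto simp: mult.commute)
    then show ?thesis by (simp add: algebra_simps)
  qed
  ultimately show ?thesis unfolding pos_affine_trans_def by blast
qed

text \<open>Comparisons with constant acts reveal when a minimum over the first set of priors is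
  positive. A prior of \<open>C'\<close> separated from \<open>C\<close> would give an act preferred
  to a constant under one representation only. Exchanging the representations gives the reverse
  inclusion.\<close>

lemma hp_rep_unique_priors:
  assumes "hope_prepare Sig X R u C D" and "hope_prepare Sig X R u' C' D'"
  shows "pos_affine_trans X u u'" and "C' \<subseteq> C"
proof -
  interpret H: hope_prepare Sig X R u C D by fact
  interpret H': hope_prepare Sig X R u' C' D' by fact
  have "u x < u y \<longleftrightarrow> u' x < u' y" if "x \<in> X" "y \<in> X" for x y
    using H.R_cact_cact[of y x] H'.R_cact_cact[of y x] that by simp
  then show tr: "pos_affine_trans X u u'"
    by (rule affine_on_unique[OF H.X H.u H'.u(1)])
  then obtain k c where k: "k > 0" "\<And>x. x \<in> X \<Longrightarrow> u' x = k * u x + c"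
    by (auto simp: pos_affine_trans_def)
  show "C' \<subseteq> C"
  proof (rule ccontr)
    assume "\<not> C' \<subseteq> C"
    then obtain p where p: "p \<in> C'" "p \<notin> C" by auto
    then have "p \<in> fa_probs Sig" using H'.C.sub by auto
    then obtain \<phi> where \<phi>: "simp_fun Sig \<phi>" "sint p \<phi> = 0" "\<And>q. q \<in> C \<Longrightarrow> 0 < sint q \<phi>"
      using strict_separation[OF H.Sig H.C.sub H.C.comp H.CD(1) _ p(2)] by metis
    obtain x B f where f: "x \<in> X" "0 < B" "f \<in> H.acts" "\<And>s. u (f s) = B * \<phi> s + u x"
      using acts_realise_profile[OF H.Sig H.X H.u \<phi>(1)] by metis
    have "0 < minf C \<phi>" using \<phi> by (simp add: H.C.less_minf_iff)
    then have "u x < minf C (\<lambda>s. u (f s))"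
      using f H.C.minf_affine[OF \<phi>(1), of B "u x"] by simp
    then have "R f (cact x)" using H.R_cact_iff[OF f(3,1)] by simp
    then have "u' x < minf C' (\<lambda>s. u' (f s))" using H'.R_cact_iff[OF f(3,1)] by simp
    also have "(\<lambda>s. u' (f s)) = (\<lambda>s. (k * B) * \<phi> s + u' x)"
      using k(2) f by (auto simp: simple_acts_iff algebra_simps)
    also have "minf C' \<dots> = (k * B) * minf C' \<phi> + u' x"
      using k f by (intro H'.C.minf_affine[OF \<phi>(1)]) auto
    finally have "0 < minf C' \<phi>" using mult_pos_pos[OF k(1) f(2)] by (simp add: zero_less_mult_iff)
    then show False using p \<phi> by (auto simp: H'.C.less_minf_iff)
  qed
qed

lemma seg_mix: "\<alpha> *\<^sub>R seg a b s + (1 - \<alpha>) *\<^sub>R seg a b t = seg a b (\<alpha> * s + (1 - \<alpha>) * t)"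
proof -
  have "seg a b t = (1/2) *\<^sub>R (a + b) + (t/2) *\<^sub>R (b - a)" for t
  proof -
    have "1 - (1 + t) / 2 = 1/2 - t/2" "(1 + t) / 2 = 1/2 + t/2" by (auto simp: field_simps)
    then show ?thesis unfolding seg_def by (simp only:) (simp add: algebra_simps)
  qed
  note e = this
  have "\<alpha> *\<^sub>R seg a b s + (1 - \<alpha>) *\<^sub>R seg a b t =
      (\<alpha> * (1/2) + (1 - \<alpha>) * (1/2)) *\<^sub>R (a + b) + (\<alpha> * (s/2) + (1 - \<alpha>) * (t/2)) *\<^sub>R (b - a)"
    unfolding e scaleR_add_right scaleR_scaleR scaleR_add_left by simp
  also have "\<dots> = seg a b (\<alpha> * s + (1 - \<alpha>) * t)"
    unfolding e by (simp add: algebra_simps add_divide_distrib diff_divide_distrib)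
  finally show ?thesis .
qed

lemma seg_minus_one [simp]: "seg a b (-1) = a" and seg_one [simp]: "seg a b 1 = b"
  by (simp_all add: seg_def)

lemma openin_unit_near:
  assumes "openin (top_of_set {0..1::real}) S" "x \<in> S"
  shows "\<exists>e>0. \<forall>y\<in>{0..1}. \<bar>y - x\<bar> < e \<longrightarrow> y \<in> S"
proof -
  obtain e where "e > 0" "\<forall>y\<in>{0..1}. dist y x < e \<longrightarrow> y \<in> S"
    using assms unfolding openin_euclidean_subtopology_iff by blast
  then show ?thesis by (auto simp: dist_real_def)
qed

section \<open>Affine utility on mixture spaces\<close>

text \<open>The utility of \<open>x\<close> is the \<open>k\<close> for which shrinking \<open>x\<close> towards the midpoint of \<open>a\<close> and \<open>b\<close>
  by a small factor \<open>\<epsilon>\<close> yields something indifferent to the point of parameter \<open>\<epsilon> k\<close> on the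
  segment; shrinking brings outcomes outside the interval between \<open>a\<close> and \<open>b\<close> into it.\<close>

lemma mixture_space_utility:
  fixes r :: "'b::real_vector \<Rightarrow> 'b \<Rightarrow> bool"
  assumes X: "convex X"
    and asym: "\<And>x y. x \<in> X \<Longrightarrow> y \<in> X \<Longrightarrow> r x y \<Longrightarrow> \<not> r y x"
    and neg: "\<And>x y z. x \<in> X \<Longrightarrow> y \<in> X \<Longrightarrow> z \<in> X \<Longrightarrow> \<not> r x y \<Longrightarrow> \<not> r y z \<Longrightarrow> \<not> r x z"
    and indep: "\<And>x y z \<alpha>. x \<in> X \<Longrightarrow> y \<in> X \<Longrightarrow> z \<in> X \<Longrightarrow> 0 < \<alpha> \<Longrightarrow> \<alpha> < 1 \<Longrightarrow>
      r x y \<longleftrightarrow> r (\<alpha> *\<^sub>R x + (1 - \<alpha>) *\<^sub>R z) (\<alpha> *\<^sub>R y + (1 - \<alpha>) *\<^sub>R z)"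
    and open1: "\<And>x y z. x \<in> X \<Longrightarrow> y \<in> X \<Longrightarrow> z \<in> X \<Longrightarrow>
      openin (top_of_set {0..1}) {\<alpha>\<in>{0..1}. r (\<alpha> *\<^sub>R x + (1 - \<alpha>) *\<^sub>R y) z}"
    and open2: "\<And>x y z. x \<in> X \<Longrightarrow> y \<in> X \<Longrightarrow> z \<in> X \<Longrightarrow>
      openin (top_of_set {0..1}) {\<alpha>\<in>{0..1}. r z (\<alpha> *\<^sub>R x + (1 - \<alpha>) *\<^sub>R y)}"
    and a: "a \<in> X" and b: "b \<in> X" and ba: "r b a"
  obtains u where "affine_on X u" "\<And>x y. x \<in> X \<Longrightarrow> y \<in> X \<Longrightarrow> r x y \<longleftrightarrow> u y < u x" "u a = -1" "u b = 1"
proof -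
  define mx where "mx \<alpha> x y = \<alpha> *\<^sub>R x + (1 - \<alpha>) *\<^sub>R y" for \<alpha> and x y :: 'b
  define eqv where "eqv x y \<longleftrightarrow> \<not> r x y \<and> \<not> r y x" for x y
  have mxX: "mx \<alpha> x y \<in> X" if "x \<in> X" "y \<in> X" "0 \<le> \<alpha>" "\<alpha> \<le> 1" for \<alpha> x y
    unfolding mx_def using that by (intro convexD[OF X]) auto
  have mx_swap: "mx \<alpha> x y = mx (1 - \<alpha>) y x" for \<alpha> x y by (simp add: mx_def add.commute)
  have mx_same: "mx \<alpha> x x = x" for \<alpha> x by (simp add: mx_def flip: scaleR_add_left)
  have segX: "seg a b t \<in> X" if "\<bar>t\<bar> \<le> 1" for t by (rule seg_in[OF X a b that])
  have mx_seg: "mx \<alpha> (seg a b s) (seg a b t) = seg a b (\<alpha> * s + (1 - \<alpha>) * t)" for \<alpha> s t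
    unfolding mx_def by (rule seg_mix)
  have irr: "\<not> r x x" if "x \<in> X" for x using asym that by blast
  have eqv_trans: "eqv x z" if "x \<in> X" "y \<in> X" "z \<in> X" "eqv x y" "eqv y z" for x y z
    using neg that unfolding eqv_def by blast
  have r_eqv: "r x' y'" if "x \<in> X" "y \<in> X" "x' \<in> X" "y' \<in> X" "eqv x x'" "eqv y y'" "r x y" for x y x' y'
    using neg[of x x' y'] neg[of x y' y] that unfolding eqv_def by blast
  have eqv_mx: "eqv (mx \<alpha> x z) (mx \<alpha> y z)"
    if "x \<in> X" "y \<in> X" "z \<in> X" "0 \<le> \<alpha>" "\<alpha> \<le> 1" "eqv x y" for x y z \<alpha>
  proof -
    consider "\<alpha> = 0" | "\<alpha> = 1" | "0 < \<alpha>" "\<alpha> < 1" using \<open>0 \<le> \<alpha>\<close> \<open>\<alpha> \<le> 1\<close> by linarith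
    then show ?thesis
    proof cases
      case 1 then show ?thesis using irr that by (simp add: mx_def eqv_def)
    next
      case 2 then show ?thesis using that by (simp add: mx_def)
    next
      case 3 then show ?thesis
        using that indep[of x y z \<alpha>] indep[of y x z \<alpha>] by (simp add: eqv_def mx_def)
    qed
  qed
  have eqv_mx2: "eqv (mx \<alpha> x y) (mx \<alpha> x' y')"
    if "x \<in> X" "y \<in> X" "x' \<in> X" "y' \<in> X" "0 \<le> \<alpha>" "\<alpha> \<le> 1" "eqv x x'" "eqv y y'" for x y x' y' \<alpha>
  proof -
    have "eqv (mx \<alpha> x y) (mx \<alpha> x' y)" using that by (intro eqv_mx)
    moreover have "eqv (mx \<alpha> x' y) (mx \<alpha> x' y')"
      unfolding mx_swap[of \<alpha> x' y] mx_swap[of \<alpha> x' y'] using that by (intro eqv_mx) auto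
    ultimately show ?thesis
      using eqv_trans[of "mx \<alpha> x y" "mx \<alpha> x' y" "mx \<alpha> x' y'"] mxX that by simp
  qed
  have mono_mx: "r (mx \<alpha> x z) (mx \<alpha> y z)"
    if "x \<in> X" "y \<in> X" "z \<in> X" "0 < \<alpha>" "\<alpha> \<le> 1" "r x y" for x y z \<alpha>
    using that indep[of x y z \<alpha>] by (cases "\<alpha> = 1") (auto simp: mx_def)
  have seg_mono: "r (seg a b t') (seg a b t)" if "-1 \<le> t" "t < t'" "t' \<le> 1" for t t'
  proof -
    have bt: "r b (seg a b t)"
    proof -
      have "r (mx ((1 - t) / 2) b b) (mx ((1 - t) / 2) a b)"
        using that by (intro mono_mx a b ba) auto
      moreover have "mx ((1 - t) / 2) a b = seg a b t"
        using mx_seg[of "(1 - t) / 2" "-1" 1] by (simp add: field_simps)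
      ultimately show ?thesis by (simp add: mx_same)
    qed
    \<comment> \<open>The weight on \<open>b\<close> that moves the parameter from \<open>t\<close>
      to \<open>t'\<close>.\<close>
    define \<mu> where "\<mu> = (t' - t) / (1 - t)"
    have \<mu>: "0 < \<mu>" "\<mu> \<le> 1" "\<mu> * (1 - t) = t' - t" using that by (auto simp: \<mu>_def)
    have "r (mx \<mu> b (seg a b t)) (mx \<mu> (seg a b t) (seg a b t))"
      using that \<mu> by (intro mono_mx b segX bt) auto
    moreover have "mx \<mu> b (seg a b t) = seg a b t'"
      using mx_seg[of \<mu> 1 t] \<mu>(3) by (simp add: algebra_simps)
    ultimately show ?thesis by (simp add: mx_same)
  qed
  have seg_iff: "r (seg a b t') (seg a b t) \<longleftrightarrow> t < t'" if "\<bar>t\<bar> \<le> 1" "\<bar>t'\<bar> \<le> 1" for t t'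
    using seg_mono[of t t'] seg_mono[of t' t] asym[OF segX segX, of t t'] irr[OF segX, of t] that
    by (cases t t' rule: linorder_cases) auto
  define m where "m = seg a b 0"
  have m: "m \<in> X" unfolding m_def by (rule segX) simp
  \<comment> \<open>The scale \<epsilon> is kept as an argument because outcomes far outside the
    segment need smaller scales. Any smaller scale also works, so two outcomes can always be
    compared at a common one.\<close>
  define U where "U \<epsilon> x k \<longleftrightarrow> 0 < \<epsilon> \<and> \<epsilon> \<le> 1 \<and> \<bar>\<epsilon> * k\<bar> \<le> 1 \<and> eqv (mx \<epsilon> x m) (seg a b (\<epsilon> * k))" for \<epsilon> x k
  have U_scale: "U (\<delta> * \<epsilon>) x k" if "x \<in> X" "U \<epsilon> x k" "0 < \<delta>" "\<delta> \<le> 1" for \<delta> \<epsilon> x k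
  proof -
    have "eqv (mx \<delta> (mx \<epsilon> x m) m) (mx \<delta> (seg a b (\<epsilon> * k)) m)"
      using that m by (intro eqv_mx mxX segX) (auto simp: U_def)
    moreover have "mx \<delta> (mx \<epsilon> x m) m = mx (\<delta> * \<epsilon>) x m"
    proof -
      have "mx \<delta> (mx \<epsilon> x m) m = (\<delta> * \<epsilon>) *\<^sub>R x + (\<delta> * (1 - \<epsilon>) + (1 - \<delta>)) *\<^sub>R m"
        by (simp only: mx_def scaleR_add_right scaleR_scaleR scaleR_add_left add.assoc)
      also have "\<delta> * (1 - \<epsilon>) + (1 - \<delta>) = 1 - \<delta> * \<epsilon>" by (simp add: algebra_simps)
      finally show ?thesis by (simp add: mx_def)
    qed
    moreover have "mx \<delta> (seg a b (\<epsilon> * k)) m = seg a b (\<delta> * \<epsilon> * k)"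
      unfolding m_def mx_seg by (simp add: mult.assoc)
    moreover have "\<bar>\<delta> * \<epsilon> * k\<bar> \<le> 1"
    proof -
      have "\<bar>\<delta> * \<epsilon> * k\<bar> = \<delta> * \<bar>\<epsilon> * k\<bar>" using that by (simp add: abs_mult)
      also have "\<dots> \<le> 1 * 1" using that by (intro mult_mono) (auto simp: U_def)
      finally show ?thesis by simp
    qed
    ultimately show ?thesis
      using that mult_mono[of \<delta> 1 \<epsilon> 1] by (simp add: U_def)
  qed
  have U_common: "\<exists>\<epsilon>. U \<epsilon> x k \<and> U \<epsilon> y l" if "x \<in> X" "y \<in> X" "U \<epsilon>1 x k" "U \<epsilon>2 y l" for x y k l \<epsilon>1 \<epsilon>2
  proof (intro exI conjI)
    show "U (\<epsilon>1 * \<epsilon>2) y l" using that by (intro U_scale) (auto simp: U_def)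
    have "U (\<epsilon>2 * \<epsilon>1) x k" using that(1,3,4) by (intro U_scale) (auto simp: U_def)
    then show "U (\<epsilon>1 * \<epsilon>2) x k" by (simp add: mult.commute)
  qed
  have U_r: "r x y \<longleftrightarrow> l < k" if "x \<in> X" "y \<in> X" "U \<epsilon>1 x k" "U \<epsilon>2 y l" for x y k l \<epsilon>1 \<epsilon>2
  proof -
    from U_common[OF that] obtain \<epsilon> where \<epsilon>: "U \<epsilon> x k" "U \<epsilon> y l" by blast
    have X': "mx \<epsilon> x m \<in> X" "mx \<epsilon> y m \<in> X" "seg a b (\<epsilon> * k) \<in> X" "seg a b (\<epsilon> * l) \<in> X"
      using that \<epsilon> m by (auto intro!: mxX segX simp: U_def)
    have "r x y \<longleftrightarrow> r (mx \<epsilon> x m) (mx \<epsilon> y m)"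
      using indep[of x y m \<epsilon>] that m \<epsilon> by (cases "\<epsilon> = 1") (auto simp: mx_def U_def)
    also have "\<dots> \<longleftrightarrow> r (seg a b (\<epsilon> * k)) (seg a b (\<epsilon> * l))"
    proof
      assume "r (mx \<epsilon> x m) (mx \<epsilon> y m)"
      then show "r (seg a b (\<epsilon> * k)) (seg a b (\<epsilon> * l))"
        by (rule r_eqv[OF X', rotated 2]) (use \<epsilon> in \<open>auto simp: U_def\<close>)
    next
      assume "r (seg a b (\<epsilon> * k)) (seg a b (\<epsilon> * l))"
      then show "r (mx \<epsilon> x m) (mx \<epsilon> y m)"
        by (rule r_eqv[OF X'(3,4,1,2), rotated 2]) (use \<epsilon> in \<open>auto simp: U_def eqv_def\<close>)
    qed
    also have "\<dots> \<longleftrightarrow> l < k" using \<epsilon> by (simp add: seg_iff U_def)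
    finally show ?thesis .
  qed
  have U_unique: "k = l" if "x \<in> X" "U \<epsilon>1 x k" "U \<epsilon>2 x l" for x k l \<epsilon>1 \<epsilon>2
    using U_r[OF that(1,1,2,3)] U_r[OF that(1,1,3,2)] irr[OF that(1)] by linarith
  have U_ex: "\<exists>k \<epsilon>. U \<epsilon> x k" if x: "x \<in> X" for x
  proof -
    have "r m a" "r b m" using seg_mono[of "-1" 0] seg_mono[of 0 1] by (auto simp: m_def)
    \<comment> \<open>Weight 0 gives \<open>m\<close>, strictly between \<open>a\<close> and
      \<open>b\<close>; by openness a small weight on \<open>x\<close> keeps the mixture strictly
      between them.\<close>
    then have z: "0 \<in> {\<alpha>\<in>{0..1}. r (\<alpha> *\<^sub>R x + (1 - \<alpha>) *\<^sub>R m) a}"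
      "0 \<in> {\<alpha>\<in>{0..1}. r b (\<alpha> *\<^sub>R x + (1 - \<alpha>) *\<^sub>R m)}" by auto
    obtain e where e: "e > 0" "\<forall>y\<in>{0..1}. \<bar>y - 0\<bar> < e \<longrightarrow>
        y \<in> {\<alpha>\<in>{0..1}. r (\<alpha> *\<^sub>R x + (1 - \<alpha>) *\<^sub>R m) a}"
      using openin_unit_near[OF open1[OF x m a] z(1)] by blast
    obtain e' where e': "e' > 0" "\<forall>y\<in>{0..1}. \<bar>y - 0\<bar> < e' \<longrightarrow>
        y \<in> {\<alpha>\<in>{0..1}. r b (\<alpha> *\<^sub>R x + (1 - \<alpha>) *\<^sub>R m)}"
      using openin_unit_near[OF open2[OF x m b] z(2)] by blast
    define \<epsilon> where "\<epsilon> = min 1 (min (e / 2) (e' / 2))"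
    have \<epsilon>: "0 < \<epsilon>" "\<epsilon> \<le> 1" "\<epsilon> < e" "\<epsilon> < e'" using e e' by (auto simp: \<epsilon>_def min_def)
    define y where "y = mx \<epsilon> x m"
    have y: "y \<in> X" "r y a" "r b y"
      using e(2)[rule_format, of \<epsilon>] e'(2)[rule_format, of \<epsilon>] \<epsilon> mxX[OF x m, of \<epsilon>] by (auto simp: y_def mx_def)
    \<comment> \<open>Disjoint open sets of weights, each nonempty. Connectedness of the unit
      interval leaves a weight in neither, so \<open>y\<close> is indifferent to a point of the
      segment.\<close>
    define S1 S2 where "S1 = {\<alpha>\<in>{0..1}. r (\<alpha> *\<^sub>R b + (1 - \<alpha>) *\<^sub>R a) y}"
      and "S2 = {\<alpha>\<in>{0..1}. r y (\<alpha> *\<^sub>R b + (1 - \<alpha>) *\<^sub>R a)}"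
    have "openin (top_of_set {0..1}) S1" "openin (top_of_set {0..1}) S2"
      unfolding S1_def S2_def by (rule open1[OF b a y(1)], rule open2[OF b a y(1)])
    moreover have "1 \<in> S1" "0 \<in> S2" using y by (auto simp: S1_def S2_def)
    moreover have "S1 \<inter> S2 = {}"
      using asym[OF _ y(1)] mxX[OF b a] by (auto simp: S1_def S2_def mx_def)
    ultimately have "\<not> {0..1} \<subseteq> S1 \<union> S2"
      using connected_Icc[of 0 "1::real"] unfolding connected_openin by blast
    then obtain t where t: "0 \<le> t" "t \<le> 1" "t \<notin> S1" "t \<notin> S2"
      unfolding subset_eq by auto
    \<comment> \<open>Weight \<open>t\<close> on \<open>b\<close> is segment parameter
      \<open>2 * t - 1\<close>; dividing by \<epsilon> afterwards undoes the shrinking.\<close>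
    have "mx t b a = seg a b (2 * t - 1)" using mx_seg[of t 1 "-1"] by (simp add: algebra_simps)
    moreover have "eqv y (mx t b a)" using t by (auto simp: S1_def S2_def eqv_def mx_def)
    ultimately have "U \<epsilon> x ((2 * t - 1) / \<epsilon>)" using \<epsilon> t by (auto simp: U_def y_def)
    then show ?thesis by blast
  qed
  then obtain u where u: "\<And>x. x \<in> X \<Longrightarrow> \<exists>\<epsilon>. U \<epsilon> x (u x)" by metis
  have seg_U: "U 1 (seg a b t) t" if "\<bar>t\<bar> \<le> 1" for t
    using that irr[OF segX[OF that]] by (simp add: U_def mx_def eqv_def)
  show ?thesis
  proof (rule that)
    show "r x y \<longleftrightarrow> u y < u x" if "x \<in> X" "y \<in> X" for x y
      using U_r u that by blast
    show "u a = -1" using u[OF a] U_unique[OF a] seg_U[of "-1"] by force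
    show "u b = 1" using u[OF b] U_unique[OF b] seg_U[of 1] by force
    show "affine_on X u"
      unfolding affine_on_def
    proof (intro ballI allI impI)
      fix x y and \<alpha> :: real assume xy: "x \<in> X" "y \<in> X" and "0 \<le> \<alpha> \<and> \<alpha> \<le> 1"
      then have \<alpha>: "0 \<le> \<alpha>" "\<alpha> \<le> 1" by auto
      obtain \<epsilon>1 \<epsilon>2 where "U \<epsilon>1 x (u x)" "U \<epsilon>2 y (u y)" using u xy by blast
      from U_common[OF xy this] obtain \<epsilon> where \<epsilon>: "U \<epsilon> x (u x)" "U \<epsilon> y (u y)" by blast
      \<comment> \<open>At a common scale, mixing commutes with shrinking towards \<open>m\<close>,
        and on the segment mixing acts linearly on parameters.\<close>
      have "eqv (mx \<alpha> (mx \<epsilon> x m) (mx \<epsilon> y m)) (mx \<alpha> (seg a b (\<epsilon> * u x)) (seg a b (\<epsilon> * u y)))"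
        using \<epsilon> xy m \<alpha> by (intro eqv_mx2 mxX segX) (auto simp: U_def)
      moreover have "mx \<alpha> (mx \<epsilon> x m) (mx \<epsilon> y m) = mx \<epsilon> (mx \<alpha> x y) m"
      proof -
        have "mx \<alpha> (mx \<epsilon> x m) (mx \<epsilon> y m) =
            (\<epsilon> * \<alpha>) *\<^sub>R x + (\<epsilon> * (1 - \<alpha>)) *\<^sub>R y + (\<alpha> * (1 - \<epsilon>) + (1 - \<alpha>) * (1 - \<epsilon>)) *\<^sub>R m"
          by (simp only: mx_def scaleR_add_right scaleR_scaleR scaleR_add_left ac_simps)
        also have "\<alpha> * (1 - \<epsilon>) + (1 - \<alpha>) * (1 - \<epsilon>) = 1 - \<epsilon>" by (simp add: algebra_simps)
        finally show ?thesis by (simp only: mx_def scaleR_add_right scaleR_scaleR)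
      qed
      moreover have "mx \<alpha> (seg a b (\<epsilon> * u x)) (seg a b (\<epsilon> * u y)) = seg a b (\<epsilon> * (\<alpha> * u x + (1 - \<alpha>) * u y))"
        unfolding mx_seg by (simp add: algebra_simps)
      moreover have "\<bar>\<epsilon> * (\<alpha> * u x + (1 - \<alpha>) * u y)\<bar> \<le> 1"
      proof -
        have "\<bar>\<alpha> * (\<epsilon> * u x) + (1 - \<alpha>) * (\<epsilon> * u y)\<bar> \<le> \<alpha> * \<bar>\<epsilon> * u x\<bar> + (1 - \<alpha>) * \<bar>\<epsilon> * u y\<bar>"
          using \<alpha> abs_triangle_ineq[of "\<alpha> * (\<epsilon> * u x)" "(1 - \<alpha>) * (\<epsilon> * u y)"] by (simp add: abs_mult)
        also have "\<dots> \<le> 1"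
          using \<alpha> \<epsilon> by (intro convex_bound_le) (auto simp: U_def)
        finally show ?thesis by (simp add: algebra_simps)
      qed
      ultimately have "U \<epsilon> (mx \<alpha> x y) (\<alpha> * u x + (1 - \<alpha>) * u y)" using \<epsilon> by (simp add: U_def)
      moreover have mX: "mx \<alpha> x y \<in> X" using xy \<alpha> by (rule mxX)
      ultimately show "u (\<alpha> *\<^sub>R x + (1 - \<alpha>) *\<^sub>R y) = \<alpha> * u x + (1 - \<alpha>) * u y"
        using u[OF mX] U_unique[OF mX] unfolding mx_def by blast
    qed
  qed
qed

section \<open>From the axioms to a representation\<close>

text \<open>The normalisation at \<open>a\<close> and \<open>b\<close> makes the segment parameter
  equal to utility.\<close>

locale hp_axioms =
  fixes Sig :: "'a set set" and X :: "'b::real_vector set" and R u a b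
  assumes Sig: "algebra UNIV Sig" and X: "convex X"
    and A1: "A1 Sig X R" and A2: "A2 Sig X R" and A3: "A3 Sig X R" and A4: "A4 Sig X R"
    and A5: "A5 Sig X R" and A7: "A7 Sig X R" and A8: "A8 Sig X R" and A9: "A9 Sig X R"
    and u: "affine_on X u" and ab: "a \<in> X" "b \<in> X" "u a = -1" "u b = 1"
    and R_cact: "\<And>x y. x \<in> X \<Longrightarrow> y \<in> X \<Longrightarrow> R (cact x) (cact y) \<longleftrightarrow> u y < u x"
begin

abbreviation acts where "acts \<equiv> simple_acts Sig X"

lemma R_trans: "f \<in> acts \<Longrightarrow> g \<in> acts \<Longrightarrow> h \<in> acts \<Longrightarrow> R f g \<Longrightarrow> R g h \<Longrightarrow> R f h"
  using A1 unfolding A1_def by blast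

lemma u_mixa:
  assumes "f \<in> acts" "g \<in> acts" "0 \<le> \<alpha>" "\<alpha> \<le> 1"
  shows "u (mixa \<alpha> f g s) = \<alpha> * u (f s) + (1 - \<alpha>) * u (g s)"
  using assms by (intro affine_on_mixa[OF u]) (auto simp: simple_acts_iff)

lemma R_dominance:
  assumes "f \<in> acts" "g \<in> acts" "\<And>s. u (g s) < u (f s)"
  shows "R f g"
  using A5 assms R_cact unfolding A5_def by (auto simp: simple_acts_iff)

lemma R_open:
  assumes fgh: "f \<in> acts" "g \<in> acts" "h \<in> acts" and R: "R f g"
  shows "\<exists>\<kappa>. 0 < \<kappa> \<and> \<kappa> < 1 \<and> R (mixa (1 - \<kappa>) f h) g"
    and "\<exists>\<kappa>. 0 < \<kappa> \<and> \<kappa> < 1 \<and> R f (mixa (1 - \<kappa>) g h)"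
proof -
  have near1: "\<exists>\<kappa>. 0 < \<kappa> \<and> \<kappa> < 1 \<and> P (1 - \<kappa>)"
    if op: "openin (top_of_set {0..1::real}) {\<alpha>\<in>{0..1}. P \<alpha>}" and 1: "P 1" for P
  proof -
    have "1 \<in> {\<alpha>\<in>{0..1}. P \<alpha>}" using 1 by simp
    from openin_unit_near[OF op this] obtain e
      where e: "e > 0" "\<forall>y\<in>{0..1}. \<bar>y - 1\<bar> < e \<longrightarrow> y \<in> {\<alpha>\<in>{0..1}. P \<alpha>}" by blast
    define \<kappa> where "\<kappa> = min (1/2) (e/2)"
    have "0 < \<kappa>" "\<kappa> < 1" "\<kappa> < e" using e by (auto simp: \<kappa>_def min_def)
    moreover from this have "P (1 - \<kappa>)" using e(2)[rule_format, of "1 - \<kappa>"] by simp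
    ultimately show ?thesis by blast
  qed
  have one: "mixa 1 f' h = f'" for f' by (simp add: mixa_def)
  show "\<exists>\<kappa>. 0 < \<kappa> \<and> \<kappa> < 1 \<and> R (mixa (1 - \<kappa>) f h) g"
    using A2 fgh R unfolding A2_def by (intro near1[of "\<lambda>\<alpha>. R (mixa \<alpha> f h) g"]) (auto simp: one)
  show "\<exists>\<kappa>. 0 < \<kappa> \<and> \<kappa> < 1 \<and> R f (mixa (1 - \<kappa>) g h)"
    using A2 fgh R unfolding A2_def by (intro near1[of "\<lambda>\<alpha>. R f (mixa \<alpha> g h)"]) (auto simp: one)
qed

text \<open>A5 yields only strict dominance. Mixing a little of \<open>a\<close> into
  \<open>f\<close> keeps the preference by openness and lowers the utility strictly, because it
  exceeds -1 in every state; \<open>f'\<close> then dominates strictly and transitivity finishes. On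
  the right side, \<open>b\<close> raises the worse act in the same way.\<close>

lemma R_mono_left:
  assumes fg: "f \<in> acts" "f' \<in> acts" "g \<in> acts" and R: "R f g"
    and le: "\<And>s. -1 < u (f s)" "\<And>s. u (f s) \<le> u (f' s)"
  shows "R f' g"
proof -
  have ca: "cact a \<in> acts" by (rule cact_in_acts[OF Sig ab(1)])
  obtain \<kappa> where \<kappa>: "0 < \<kappa>" "\<kappa> < 1" "R (mixa (1 - \<kappa>) f (cact a)) g"
    using R_open(1)[OF fg(1,3) ca R] by blast
  have m: "mixa (1 - \<kappa>) f (cact a) \<in> acts" using \<kappa> by (intro mixa_in_acts[OF Sig X] fg ca) auto
  have "u (mixa (1 - \<kappa>) f (cact a) s) < u (f' s)" for s
  proof -
    have "u (mixa (1 - \<kappa>) f (cact a) s) = u (f s) - \<kappa> * (u (f s) + 1)"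
      using u_mixa[OF fg(1) ca, of "1 - \<kappa>" s] \<kappa> ab by (simp add: cact_def algebra_simps)
    also have "\<dots> < u (f s)" using \<kappa> le(1)[of s] by simp
    finally show ?thesis using le(2)[of s] by simp
  qed
  then have "R f' (mixa (1 - \<kappa>) f (cact a))" by (rule R_dominance[OF fg(2) m])
  then show ?thesis using R_trans[OF fg(2) m fg(3)] \<kappa> by blast
qed

lemma R_mono_right:
  assumes fg: "f \<in> acts" "g \<in> acts" "g' \<in> acts" and R: "R f g"
    and le: "\<And>s. u (g s) < 1" "\<And>s. u (g' s) \<le> u (g s)"
  shows "R f g'"
proof -
  have cb: "cact b \<in> acts" by (rule cact_in_acts[OF Sig ab(2)])
  obtain \<kappa> where \<kappa>: "0 < \<kappa>" "\<kappa> < 1" "R f (mixa (1 - \<kappa>) g (cact b))"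
    using R_open(2)[OF fg(1,2) cb R] by blast
  have m: "mixa (1 - \<kappa>) g (cact b) \<in> acts" using \<kappa> by (intro mixa_in_acts[OF Sig X] fg cb) auto
  have "u (g' s) < u (mixa (1 - \<kappa>) g (cact b) s)" for s
  proof -
    have "u (mixa (1 - \<kappa>) g (cact b) s) = u (g s) + \<kappa> * (1 - u (g s))"
      using u_mixa[OF fg(2) cb, of "1 - \<kappa>" s] \<kappa> ab by (simp add: cact_def algebra_simps)
    also have "\<dots> > u (g s)" using \<kappa> le(1)[of s] by simp
    finally show ?thesis using le(2)[of s] by simp
  qed
  then have "R (mixa (1 - \<kappa>) g (cact b)) g'" by (rule R_dominance[OF m fg(3)])
  then show ?thesis using R_trans[OF fg(1) m fg(3)] \<kappa> by blast
qed

section \<open>The preference transported to utility profiles\<close>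

definition sa :: "('a \<Rightarrow> real) \<Rightarrow> 'a \<Rightarrow> 'b" where
  "sa \<phi> = (\<lambda>s. seg a b (\<phi> s))"

abbreviation simple where "simple \<equiv> simp_fun Sig"

lemma sa_acts: "simple \<phi> \<Longrightarrow> (\<And>s. \<bar>\<phi> s\<bar> \<le> 1) \<Longrightarrow> sa \<phi> \<in> acts"
  unfolding sa_def simple_acts_iff
  by (auto intro: seg_in[OF X ab(1,2)] simp_fun_comp[OF Sig, where h = "seg a b"])

lemma u_sa: "\<bar>\<phi> s\<bar> \<le> 1 \<Longrightarrow> u (sa \<phi> s) = \<phi> s"
  unfolding sa_def using affine_on_seg[OF u ab(1,2), of "\<phi> s"] ab by (simp add: field_simps)

lemma sa_const: "sa (\<lambda>s. c) = cact (seg a b c)"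
  by (simp add: sa_def cact_def)

lemma sa_mixa: "mixa \<alpha> (sa \<phi>) (sa \<psi>) = sa (\<lambda>s. \<alpha> * \<phi> s + (1 - \<alpha>) * \<psi> s)"
  by (simp add: mixa_def sa_def seg_mix)

text \<open>The preference transported to utility profiles: \<open>Q\<close> lives on all simple functions because
  profiles are first shrunk into the range of the segment.\<close>

definition Q :: "('a \<Rightarrow> real) \<Rightarrow> ('a \<Rightarrow> real) \<Rightarrow> bool" where
  "Q \<phi> \<psi> \<longleftrightarrow> (\<exists>\<epsilon>>0. (\<forall>s. \<bar>\<epsilon> * \<phi> s\<bar> \<le> 1 \<and> \<bar>\<epsilon> * \<psi> s\<bar> \<le> 1) \<and>
     R (sa (\<lambda>s. \<epsilon> * \<phi> s)) (sa (\<lambda>s. \<epsilon> * \<psi> s)))"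

lemma simp_scale: "simple \<phi> \<Longrightarrow> simple (\<lambda>s. c * \<phi> s)"
  by (rule simp_fun_comp[OF Sig])

text \<open>A3 on profiles: \<open>c = 0\<close> will give invariance under scaling, and other
  values invariance under adding constants.\<close>

lemma R_sa_scale:
  assumes \<phi>: "simple \<phi>" "simple \<psi>" and b: "\<And>s. \<bar>\<phi> s\<bar> \<le> 1" "\<And>s. \<bar>\<psi> s\<bar> \<le> 1" and \<alpha>: "0 < \<alpha>" "\<alpha> \<le> 1"
    and c: "\<bar>c\<bar> \<le> 1"
  shows "R (sa \<phi>) (sa \<psi>) \<longleftrightarrow> R (sa (\<lambda>s. \<alpha> * \<phi> s + (1 - \<alpha>) * c)) (sa (\<lambda>s. \<alpha> * \<psi> s + (1 - \<alpha>) * c))"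
proof (cases "\<alpha> = 1")
  case False
  then have "R (sa \<phi>) (sa \<psi>) \<longleftrightarrow> R (mixa \<alpha> (sa \<phi>) (cact (seg a b c))) (mixa \<alpha> (sa \<psi>) (cact (seg a b c)))"
    using A3 sa_acts[OF \<phi>(1) b(1)] sa_acts[OF \<phi>(2) b(2)] seg_in[OF X ab(1,2) c] \<alpha>
    unfolding A3_def by simp
  then show ?thesis by (simp add: sa_mixa flip: sa_const)
qed simp

text \<open>The choice of scale is immaterial: of two admissible scales the smaller is a shrinking
  of the larger towards the midpoint, which A3 permits.\<close>

lemma Q_iff:
  assumes \<phi>: "simple \<phi>" "simple \<psi>" and \<epsilon>: "0 < \<epsilon>" "\<And>s. \<bar>\<epsilon> * \<phi> s\<bar> \<le> 1" "\<And>s. \<bar>\<epsilon> * \<psi> s\<bar> \<le> 1"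
  shows "Q \<phi> \<psi> \<longleftrightarrow> R (sa (\<lambda>s. \<epsilon> * \<phi> s)) (sa (\<lambda>s. \<epsilon> * \<psi> s))"
proof -
  have eq: "R (sa (\<lambda>s. \<epsilon> * \<phi> s)) (sa (\<lambda>s. \<epsilon> * \<psi> s)) \<longleftrightarrow> R (sa (\<lambda>s. \<delta> * \<phi> s)) (sa (\<lambda>s. \<delta> * \<psi> s))"
    if "0 < \<delta>" "\<delta> \<le> \<epsilon>" "\<And>s. \<bar>\<epsilon> * \<phi> s\<bar> \<le> 1" "\<And>s. \<bar>\<epsilon> * \<psi> s\<bar> \<le> 1" for \<delta> \<epsilon>
    using R_sa_scale[OF simp_scale[OF \<phi>(1)] simp_scale[OF \<phi>(2)] that(3,4), of "\<delta> / \<epsilon>" 0] that(1,2)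
    by simp
  have "R (sa (\<lambda>s. \<epsilon> * \<phi> s)) (sa (\<lambda>s. \<epsilon> * \<psi> s)) \<longleftrightarrow> R (sa (\<lambda>s. \<delta> * \<phi> s)) (sa (\<lambda>s. \<delta> * \<psi> s))"
    if "0 < \<delta>" "\<And>s. \<bar>\<delta> * \<phi> s\<bar> \<le> 1" "\<And>s. \<bar>\<delta> * \<psi> s\<bar> \<le> 1" for \<delta>
    using eq[of \<delta> \<epsilon>] eq[of \<epsilon> \<delta>] that \<epsilon> by (cases "\<delta> \<le> \<epsilon>") auto
  then show ?thesis unfolding Q_def using \<epsilon> by blast
qed

lemma small_scale:
  assumes F: "finite F" "\<And>\<phi>. \<phi> \<in> F \<Longrightarrow> simple \<phi>"
  shows "\<exists>\<epsilon>::real. 0 < \<epsilon> \<and> \<epsilon> < 1 \<and> (\<forall>\<phi>\<in>F. \<forall>s. \<bar>\<epsilon> * \<phi> s\<bar> < 1/2)"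
  using F
proof (induction F rule: finite_induct)
  case empty
  show ?case by (intro exI[of _ "1/2"]) simp
next
  case (insert \<phi> F)
  then obtain \<epsilon> where \<epsilon>: "0 < \<epsilon>" "\<epsilon> < 1" "\<And>\<phi> s. \<phi> \<in> F \<Longrightarrow> \<bar>\<epsilon> * \<phi> s\<bar> < 1/2" by auto
  obtain M where M: "M > 0" "\<And>s. \<bar>\<phi> s\<bar> \<le> M" using simp_fun_bounded[OF insert.prems[of \<phi>]] by auto
  \<comment> \<open>The factor 3 bounds the scaled new function by 1/3, strictly below 1/2.\<close>
  define \<delta> where "\<delta> = min \<epsilon> (1 / (3 * M))"
  have \<delta>: "0 < \<delta>" "\<delta> \<le> \<epsilon>" "\<delta> \<le> 1 / (3 * M)" using \<epsilon> M by (auto simp: \<delta>_def)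
  have "\<bar>\<delta> * \<psi> s\<bar> < 1/2" if "\<psi> \<in> F" for \<psi> s
  proof -
    have "\<bar>\<delta> * \<psi> s\<bar> \<le> \<bar>\<epsilon> * \<psi> s\<bar>" using \<delta> by (simp add: abs_mult mult_right_mono)
    then show ?thesis using \<epsilon>(3)[OF that, of s] by simp
  qed
  moreover have "\<bar>\<delta> * \<phi> s\<bar> < 1/2" for s
  proof -
    have "\<bar>\<delta> * \<phi> s\<bar> \<le> 1 / (3 * M) * M" using \<delta> M by (simp only: abs_mult) (intro mult_mono, auto)
    also have "\<dots> < 1/2" using M by simp
    finally show ?thesis .
  qed
  ultimately show ?case using \<delta> \<epsilon> by (intro exI[of _ \<delta>]) auto
qed

text \<open>The bound 1/2 leaves room below 1, as the strict hypotheses of the monotonicity lemmas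
  and the estimate in \<open>Q_open\<close> require.\<close>

definition fits :: "real \<Rightarrow> ('a \<Rightarrow> real) \<Rightarrow> bool" where
  "fits \<epsilon> \<phi> \<longleftrightarrow> simple \<phi> \<and> (\<forall>s. \<bar>\<epsilon> * \<phi> s\<bar> < 1/2)"

lemma fits_ex:
  assumes "finite F" "\<And>\<phi>. \<phi> \<in> F \<Longrightarrow> simple \<phi>"
  shows "\<exists>\<epsilon>. 0 < \<epsilon> \<and> \<epsilon> < 1 \<and> (\<forall>\<phi>\<in>F. fits \<epsilon> \<phi>)"
  using small_scale[OF assms] assms(2) unfolding fits_def by blast

lemma fits_le: "fits \<epsilon> \<phi> \<Longrightarrow> \<bar>\<epsilon> * \<phi> s\<bar> \<le> 1"
  unfolding fits_def by (drule conjunct2, drule spec[of _ s]) linarith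

lemma sa_fits: "fits \<epsilon> \<phi> \<Longrightarrow> sa (\<lambda>s. \<epsilon> * \<phi> s) \<in> acts"
  by (intro sa_acts simp_scale fits_le) (simp_all add: fits_def)

lemma u_sa_fits: "fits \<epsilon> \<phi> \<Longrightarrow> u (sa (\<lambda>s. \<epsilon> * \<phi> s) s) = \<epsilon> * \<phi> s"
  by (rule u_sa[OF fits_le])

lemma Q_fits:
  "0 < \<epsilon> \<Longrightarrow> fits \<epsilon> \<phi> \<Longrightarrow> fits \<epsilon> \<psi> \<Longrightarrow> Q \<phi> \<psi> \<longleftrightarrow> R (sa (\<lambda>s. \<epsilon> * \<phi> s)) (sa (\<lambda>s. \<epsilon> * \<psi> s))"
  by (intro Q_iff fits_le) (simp_all add: fits_def)

text \<open>Acts need not take values on the segment. Shrinking both acts towards its midpoint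
  preserves the preference by A3 and makes the utilities small; weak monotonicity in both directions
  then replaces each act by the segment act with the same profile.\<close>

lemma R_iff_Q:
  assumes f: "f \<in> acts" and g: "g \<in> acts"
  shows "R f g \<longleftrightarrow> Q (\<lambda>s. u (f s)) (\<lambda>s. u (g s))"
proof -
  let ?\<phi> = "\<lambda>s. u (f s)" and ?\<psi> = "\<lambda>s. u (g s)"
  have "simple ?\<phi>" "simple ?\<psi>" using simp_fun_utility[OF Sig] f g by auto
  then obtain \<epsilon> where \<epsilon>: "0 < \<epsilon>" "\<epsilon> < 1" "fits \<epsilon> ?\<phi>" "fits \<epsilon> ?\<psi>"
    using fits_ex[of "{?\<phi>, ?\<psi>}"] by auto
  let ?m = "cact (seg a b 0)"
  let ?F = "mixa \<epsilon> f ?m" and ?G = "mixa \<epsilon> g ?m"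
  let ?f = "sa (\<lambda>s. \<epsilon> * u (f s))" and ?g = "sa (\<lambda>s. \<epsilon> * u (g s))"
  have mX: "seg a b 0 \<in> X" by (rule seg_in[OF X ab(1,2)]) simp
  have um: "u (seg a b 0) = 0" using affine_on_seg[OF u ab(1,2), of 0] ab by simp
  have m: "?m \<in> acts" by (rule cact_in_acts[OF Sig mX])
  have FG: "?F \<in> acts" "?G \<in> acts" using \<epsilon> by (auto intro!: mixa_in_acts[OF Sig X] f g m)
  have uFG: "u (?F s) = \<epsilon> * u (f s)" "u (?G s) = \<epsilon> * u (g s)" for s
    using u_mixa[OF f m, of \<epsilon> s] u_mixa[OF g m, of \<epsilon> s] \<epsilon>(1,2) um by (auto simp: cact_def)
  have fg: "?f \<in> acts" "?g \<in> acts" "\<And>s. u (?f s) = \<epsilon> * u (f s)" "\<And>s. u (?g s) = \<epsilon> * u (g s)"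
    using sa_fits u_sa_fits \<epsilon> by auto
  have bd: "-1 < \<epsilon> * u (f s)" "\<epsilon> * u (g s) < 1" for s
  proof -
    have "\<bar>\<epsilon> * u (f s)\<bar> < 1/2" "\<bar>\<epsilon> * u (g s)\<bar> < 1/2" using \<epsilon>(3,4) by (auto simp: fits_def)
    then show "-1 < \<epsilon> * u (f s)" "\<epsilon> * u (g s) < 1" by linarith+
  qed
  have "R f g \<longleftrightarrow> R ?F ?G" using A3 f g mX \<epsilon>(1,2) unfolding A3_def by simp
  also have "\<dots> \<longleftrightarrow> R ?f ?g"
  proof
    assume "R ?F ?G"
    then have "R ?f ?G" using bd by (intro R_mono_left[OF FG(1) fg(1) FG(2)]) (auto simp: uFG fg)
    then show "R ?f ?g" using bd by (intro R_mono_right[OF fg(1) FG(2) fg(2)]) (auto simp: uFG fg)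
  next
    assume "R ?f ?g"
    then have "R ?F ?g" using bd by (intro R_mono_left[OF fg(1) FG(1) fg(2)]) (auto simp: uFG fg)
    then show "R ?F ?G" using bd by (intro R_mono_right[OF FG(1) fg(2) FG(2)]) (auto simp: uFG fg)
  qed
  also have "\<dots> \<longleftrightarrow> Q ?\<phi> ?\<psi>" using Q_fits[OF \<epsilon>(1,3,4)] by simp
  finally show ?thesis .
qed

lemma simple_affine: "simple \<phi> \<Longrightarrow> simple (\<lambda>s. c * \<phi> s + d)"
  by (rule simp_fun_comp[OF Sig])

lemma simple_plus: "simple \<phi> \<Longrightarrow> simple \<psi> \<Longrightarrow> simple (\<lambda>s. \<phi> s + \<psi> s)"
  by (rule simp_fun_comp2[OF Sig])

lemma simple_const: "simple (\<lambda>s. c)"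
  by (rule simp_fun_const[OF Sig])

lemma Q_mono:
  assumes s: "simple \<phi>" "simple \<psi>" "simple \<phi>'" "simple \<psi>'" and Q: "Q \<phi> \<psi>"
    and le: "\<And>s. \<phi> s \<le> \<phi>' s" "\<And>s. \<psi>' s \<le> \<psi> s"
  shows "Q \<phi>' \<psi>'"
proof -
  obtain \<epsilon> where \<epsilon>: "0 < \<epsilon>" "fits \<epsilon> \<phi>" "fits \<epsilon> \<psi>" "fits \<epsilon> \<phi>'" "fits \<epsilon> \<psi>'"
    using fits_ex[of "{\<phi>, \<psi>, \<phi>', \<psi>'}"] s by auto
  note acts = sa_fits[OF \<epsilon>(2)] sa_fits[OF \<epsilon>(3)] sa_fits[OF \<epsilon>(4)] sa_fits[OF \<epsilon>(5)]
  have bd: "-1 < \<epsilon> * \<phi> s" "\<epsilon> * \<psi> s < 1" for s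
  proof -
    have "\<bar>\<epsilon> * \<phi> s\<bar> < 1/2" "\<bar>\<epsilon> * \<psi> s\<bar> < 1/2" using \<epsilon> by (auto simp: fits_def)
    then show "-1 < \<epsilon> * \<phi> s" "\<epsilon> * \<psi> s < 1" by linarith+
  qed
  have "R (sa (\<lambda>s. \<epsilon> * \<phi> s)) (sa (\<lambda>s. \<epsilon> * \<psi> s))" using Q Q_fits[OF \<epsilon>(1-3)] by simp
  then have "R (sa (\<lambda>s. \<epsilon> * \<phi>' s)) (sa (\<lambda>s. \<epsilon> * \<psi> s))"
    by (rule R_mono_left[OF acts(1,3,2)]) (use \<epsilon> bd le in \<open>auto simp: u_sa_fits\<close>)
  then have "R (sa (\<lambda>s. \<epsilon> * \<phi>' s)) (sa (\<lambda>s. \<epsilon> * \<psi>' s))"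
    by (rule R_mono_right[OF acts(3,2,4)]) (use \<epsilon> bd le in \<open>auto simp: u_sa_fits\<close>)
  then show ?thesis using Q_fits[OF \<epsilon>(1,4,5)] by simp
qed

lemma Q_scale:
  assumes s: "simple \<phi>" "simple \<psi>" and c: "0 < c"
  shows "Q (\<lambda>s. c * \<phi> s) (\<lambda>s. c * \<psi> s) \<longleftrightarrow> Q \<phi> \<psi>"
proof -
  have s': "simple (\<lambda>s. c * \<phi> s)" "simple (\<lambda>s. c * \<psi> s)" using s simp_scale by auto
  then obtain \<epsilon> where \<epsilon>: "0 < \<epsilon>" "fits \<epsilon> (\<lambda>s. c * \<phi> s)" "fits \<epsilon> (\<lambda>s. c * \<psi> s)"
    using fits_ex[of "{\<lambda>s. c * \<phi> s, \<lambda>s. c * \<psi> s}"] by auto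
  have "Q \<phi> \<psi> \<longleftrightarrow> R (sa (\<lambda>s. (\<epsilon> * c) * \<phi> s)) (sa (\<lambda>s. (\<epsilon> * c) * \<psi> s))"
    using fits_le[OF \<epsilon>(2)] fits_le[OF \<epsilon>(3)] \<epsilon>(1) c by (intro Q_iff s) (auto simp: mult.assoc)
  then show ?thesis using Q_fits[OF \<epsilon>] by (simp add: mult.assoc)
qed

text \<open>The half mixture with the constant of utility \<open>\<epsilon> * c\<close> turns a
  profile at scale \<epsilon> into the shifted profile at scale
  \<open>\<epsilon> / 2\<close>.\<close>

lemma Q_shift:
  assumes s: "simple \<phi>" "simple \<psi>"
  shows "Q (\<lambda>s. \<phi> s + c) (\<lambda>s. \<psi> s + c) \<longleftrightarrow> Q \<phi> \<psi>"
proof -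
  have s': "simple (\<lambda>s. \<phi> s + c)" "simple (\<lambda>s. \<psi> s + c)" using s simple_affine[of _ 1 c] by auto
  then obtain \<epsilon> where \<epsilon>: "0 < \<epsilon>" "fits \<epsilon> \<phi>" "fits \<epsilon> \<psi>" "fits \<epsilon> (\<lambda>s. c)" "fits \<epsilon> (\<lambda>s. \<phi> s + c)" "fits \<epsilon> (\<lambda>s. \<psi> s + c)"
    using fits_ex[of "{\<phi>, \<psi>, \<lambda>s. c, \<lambda>s. \<phi> s + c, \<lambda>s. \<psi> s + c}"] s simple_const[of c] by auto
  have half: "fits (\<epsilon> / 2) \<xi>" if "fits \<epsilon> \<xi>" for \<xi>
  proof -
    have "\<bar>\<epsilon> / 2 * \<xi> s\<bar> < 1/2" for s
    proof -
      have "\<bar>\<epsilon> * \<xi> s\<bar> < 1/2" using that by (auto simp: fits_def)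
      moreover have "\<epsilon> / 2 * \<xi> s = (\<epsilon> * \<xi> s) / 2" by simp
      ultimately show ?thesis by linarith
    qed
    then show ?thesis using that by (auto simp: fits_def)
  qed
  have "Q \<phi> \<psi> \<longleftrightarrow> R (sa (\<lambda>s. \<epsilon> * \<phi> s)) (sa (\<lambda>s. \<epsilon> * \<psi> s))" by (rule Q_fits[OF \<epsilon>(1-3)])
  also have "\<dots> \<longleftrightarrow> R (sa (\<lambda>s. 1/2 * (\<epsilon> * \<phi> s) + (1 - 1/2) * (\<epsilon> * c))) (sa (\<lambda>s. 1/2 * (\<epsilon> * \<psi> s) + (1 - 1/2) * (\<epsilon> * c)))"
    using fits_le[OF \<epsilon>(4)] by (intro R_sa_scale simp_scale s fits_le \<epsilon>) auto
  also have "\<dots> \<longleftrightarrow> R (sa (\<lambda>s. \<epsilon> / 2 * (\<phi> s + c))) (sa (\<lambda>s. \<epsilon> / 2 * (\<psi> s + c)))"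
    by (simp add: algebra_simps add_divide_distrib)
  also have "\<dots> \<longleftrightarrow> Q (\<lambda>s. \<phi> s + c) (\<lambda>s. \<psi> s + c)"
    using \<epsilon>(1) by (intro Q_fits[symmetric] half \<epsilon>) auto
  finally show ?thesis by simp
qed

lemma Q_trans:
  assumes s: "simple \<phi>" "simple \<psi>" "simple \<xi>" and Q: "Q \<phi> \<psi>" "Q \<psi> \<xi>"
  shows "Q \<phi> \<xi>"
proof -
  obtain \<epsilon> where \<epsilon>: "0 < \<epsilon>" "fits \<epsilon> \<phi>" "fits \<epsilon> \<psi>" "fits \<epsilon> \<xi>"
    using fits_ex[of "{\<phi>, \<psi>, \<xi>}"] s by auto
  show ?thesis
    using Q R_trans[OF sa_fits[OF \<epsilon>(2)] sa_fits[OF \<epsilon>(3)] sa_fits[OF \<epsilon>(4)]]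
      Q_fits[OF \<epsilon>(1,2,3)] Q_fits[OF \<epsilon>(1,3,4)] Q_fits[OF \<epsilon>(1,2,4)] by blast
qed

lemma Q_const: "Q (\<lambda>s. c) (\<lambda>s. d) \<longleftrightarrow> d < c"
proof -
  obtain \<epsilon> where \<epsilon>: "0 < \<epsilon>" "fits \<epsilon> (\<lambda>s. c)" "fits \<epsilon> (\<lambda>s. d)"
    using fits_ex[of "{\<lambda>s. c, \<lambda>s. d}"] simple_const[of c] simple_const[of d] by auto
  have le: "\<bar>\<epsilon> * c\<bar> \<le> 1" "\<bar>\<epsilon> * d\<bar> \<le> 1" using fits_le[OF \<epsilon>(2)] fits_le[OF \<epsilon>(3)] by auto
  have "Q (\<lambda>s. c) (\<lambda>s. d) \<longleftrightarrow> u (seg a b (\<epsilon> * d)) < u (seg a b (\<epsilon> * c))"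
    unfolding Q_fits[OF \<epsilon>] sa_const by (intro R_cact seg_in[OF X ab(1,2)] le)
  also have "\<dots> \<longleftrightarrow> \<epsilon> * d < \<epsilon> * c"
    using u_sa[of "\<lambda>s. \<epsilon> * d"] u_sa[of "\<lambda>s. \<epsilon> * c"] le by (simp add: sa_def)
  finally show ?thesis using \<epsilon>(1) by simp
qed

lemma Q_open:
  assumes s: "simple \<phi>" "simple \<psi>" and Q: "Q \<phi> \<psi>"
  shows "\<exists>\<delta>>0. Q (\<lambda>s. \<phi> s - \<delta>) \<psi>"
proof -
  obtain \<epsilon> where \<epsilon>: "0 < \<epsilon>" "fits \<epsilon> \<phi>" "fits \<epsilon> \<psi>"
    using fits_ex[of "{\<phi>, \<psi>}"] s by auto
  have "R (sa (\<lambda>s. \<epsilon> * \<phi> s)) (sa (\<lambda>s. \<epsilon> * \<psi> s))" using Q Q_fits[OF \<epsilon>] by simp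
  then obtain \<kappa> where \<kappa>: "0 < \<kappa>" "\<kappa> < 1"
    "R (mixa (1 - \<kappa>) (sa (\<lambda>s. \<epsilon> * \<phi> s)) (cact a)) (sa (\<lambda>s. \<epsilon> * \<psi> s))"
    using R_open(1)[OF sa_fits[OF \<epsilon>(2)] sa_fits[OF \<epsilon>(3)] cact_in_acts[OF Sig ab(1)]] by blast
  \<comment> \<open>The profile after mixing with \<open>a\<close>, whose utility is -1, written at
    the original scale.\<close>
  define \<phi>' where "\<phi>' = (\<lambda>s. (1 - \<kappa>) * \<phi> s + (- \<kappa> / \<epsilon>))"
  have s': "simple \<phi>'" unfolding \<phi>'_def by (rule simple_affine[OF s(1)])
  have e: "\<epsilon> * \<phi>' s = (1 - \<kappa>) * (\<epsilon> * \<phi> s) + (1 - (1 - \<kappa>)) * (-1)" for s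
    using \<epsilon>(1) by (simp add: \<phi>'_def field_simps)
  have "mixa (1 - \<kappa>) (sa (\<lambda>s. \<epsilon> * \<phi> s)) (cact a) = sa (\<lambda>s. \<epsilon> * \<phi>' s)"
  proof -
    have c: "cact a = sa (\<lambda>s. -1)" by (simp add: sa_const)
    show ?thesis unfolding e c by (rule sa_mixa)
  qed
  moreover have "\<bar>\<epsilon> * \<phi>' s\<bar> \<le> 1" for s
  proof -
    have "\<bar>\<epsilon> * \<phi>' s\<bar> \<le> (1 - \<kappa>) * \<bar>\<epsilon> * \<phi> s\<bar> + \<kappa> * 1"
      unfolding e using abs_triangle_ineq[of "(1 - \<kappa>) * (\<epsilon> * \<phi> s)" "- \<kappa>"] \<kappa> by (simp add: abs_mult)
    also have "\<dots> \<le> 1" using \<kappa> fits_le[OF \<epsilon>(2)] by (intro convex_bound_le) auto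
    finally show ?thesis .
  qed
  ultimately have "Q \<phi>' \<psi>" using \<kappa>(3) fits_le[OF \<epsilon>(3)] Q_iff[OF s' s(2) \<epsilon>(1)] by simp
  \<comment> \<open>The mixture loses \<open>\<kappa> * (\<epsilon> * \<phi> s + 1)\<close>, at
    least \<open>\<kappa> / 2\<close> by the bound 1/2 in \<open>fits\<close>. This makes the loss
    uniform over states.\<close>
  moreover have "\<phi>' s \<le> \<phi> s - \<kappa> / (2 * \<epsilon>)" for s
  proof -
    have "\<bar>\<epsilon> * \<phi> s\<bar> < 1/2" using \<epsilon> by (auto simp: fits_def)
    then have "- (1/2) \<le> \<epsilon> * \<phi> s" by linarith
    then have "\<kappa> * (- (1/2)) \<le> \<kappa> * (\<epsilon> * \<phi> s)" using \<kappa> by (intro mult_left_mono) auto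
    then have "\<epsilon> * \<phi>' s \<le> \<epsilon> * (\<phi> s - \<kappa> / (2 * \<epsilon>))" unfolding e using \<epsilon>(1) by (simp add: algebra_simps)
    then show ?thesis using \<epsilon>(1) by simp
  qed
  ultimately have "Q (\<lambda>s. \<phi> s - \<kappa> / (2 * \<epsilon>)) \<psi>"
    using Q_mono[OF s' s(2) _ s(2)] simple_affine[OF s(1), of 1 "- \<kappa> / (2 * \<epsilon>)"] by simp
  then show ?thesis using \<kappa> \<epsilon>(1) by (intro exI[of _ "\<kappa> / (2 * \<epsilon>)"]) simp
qed

text \<open>Convexity from A4, at weight 1/2, combined with scale invariance makes the profiles
  preferred to 0 closed under addition.\<close>

lemma Q_add:
  assumes s: "simple \<phi>" "simple \<psi>" and Q: "Q \<phi> (\<lambda>s. 0)" "Q \<psi> (\<lambda>s. 0)"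
  shows "Q (\<lambda>s. \<phi> s + \<psi> s) (\<lambda>s. 0)"
proof -
  obtain \<epsilon> where \<epsilon>: "0 < \<epsilon>" "fits \<epsilon> \<phi>" "fits \<epsilon> \<psi>" "fits \<epsilon> (\<lambda>s. 0)"
    using fits_ex[of "{\<phi>, \<psi>, \<lambda>s. 0}"] s simple_const[of 0] by auto
  have m: "seg a b 0 \<in> X" by (rule seg_in[OF X ab(1,2)]) simp
  have "R (sa (\<lambda>s. \<epsilon> * \<phi> s)) (cact (seg a b 0))" "R (sa (\<lambda>s. \<epsilon> * \<psi> s)) (cact (seg a b 0))"
    using Q Q_fits[OF \<epsilon>(1,2,4)] Q_fits[OF \<epsilon>(1,3,4)] by (auto simp: sa_const)
  then have "R (mixa (1/2) (sa (\<lambda>s. \<epsilon> * \<phi> s)) (sa (\<lambda>s. \<epsilon> * \<psi> s))) (cact (seg a b 0))"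
    using A4 sa_fits[OF \<epsilon>(2)] sa_fits[OF \<epsilon>(3)] m unfolding A4_def by auto
  moreover have "R (sa (\<lambda>s. (\<epsilon> / 2) * (\<phi> s + \<psi> s))) (sa (\<lambda>s. (\<epsilon> / 2) * 0))"
    if "R (mixa (1/2) (sa (\<lambda>s. \<epsilon> * \<phi> s)) (sa (\<lambda>s. \<epsilon> * \<psi> s))) (cact (seg a b 0))"
  proof -
    have "(\<lambda>s. 1/2 * (\<epsilon> * \<phi> s) + (1 - 1/2) * (\<epsilon> * \<psi> s)) = (\<lambda>s. (\<epsilon> / 2) * (\<phi> s + \<psi> s))"
      by (simp add: fun_eq_iff field_simps)
    with that show ?thesis unfolding sa_mixa by (simp add: sa_const)
  qed
  moreover have "\<bar>(\<epsilon> / 2) * (\<phi> s + \<psi> s)\<bar> \<le> 1" for s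
  proof -
    have e: "(\<epsilon> / 2) * (\<phi> s + \<psi> s) = (\<epsilon> * \<phi> s + \<epsilon> * \<psi> s) / 2" by (simp add: algebra_simps)
    have "\<bar>(x + y) / 2\<bar> \<le> 1" if "\<bar>x\<bar> \<le> 1" "\<bar>y\<bar> \<le> 1" for x y :: real
      using that by (simp add: abs_le_iff)
    then show ?thesis unfolding e using fits_le[OF \<epsilon>(2)] fits_le[OF \<epsilon>(3)] by blast
  qed
  ultimately show ?thesis
    using Q_iff[OF simple_plus[OF s] simple_const[of 0], of "\<epsilon> / 2"] \<epsilon>(1) by simp
qed

text \<open>A profile and its negative give complementary acts whose half mixture has utility 0; A8
  and A9 are the two directions.\<close>

lemma Q_reflect:
  assumes s: "simple \<phi>"
  shows "Q (\<lambda>s. 0) (\<lambda>s. - \<phi> s) \<longleftrightarrow> Q \<phi> (\<lambda>s. 0)"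
proof -
  have s': "simple (\<lambda>s. - \<phi> s)" using simp_scale[OF s, of "-1"] by simp
  obtain \<epsilon> where \<epsilon>: "0 < \<epsilon>" "fits \<epsilon> \<phi>" "fits \<epsilon> (\<lambda>s. - \<phi> s)" "fits \<epsilon> (\<lambda>s. 0)"
    using fits_ex[of "{\<phi>, \<lambda>s. - \<phi> s, \<lambda>s. 0}"] s s' simple_const[of 0] by auto
  let ?f = "sa (\<lambda>s. \<epsilon> * \<phi> s)" and ?g = "sa (\<lambda>s. \<epsilon> * (- \<phi> s))"
  have mix: "mixa (1/2) ?f ?g = sa (\<lambda>s. \<epsilon> * 0)" by (simp add: sa_mixa)
  have m: "seg a b 0 \<in> X" by (rule seg_in[OF X ab(1,2)]) simp
  have "(1/2) *\<^sub>R ?f s + (1/2) *\<^sub>R ?g s = seg a b 0" for s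
    using fun_cong[OF mix, of s] by (simp add: mixa_def sa_def)
  then have "complementary R ?f ?g"
    unfolding complementary_def incomp_def using R_cact[OF m m] by simp
  then have "R ?f (mixa (1/2) ?f ?g) \<longleftrightarrow> R (mixa (1/2) ?f ?g) ?g"
    using A8 A9 sa_fits[OF \<epsilon>(2)] sa_fits[OF \<epsilon>(3)] unfolding A8_def A9_def by blast
  then show ?thesis unfolding mix using Q_fits[OF \<epsilon>(1,2,4)] Q_fits[OF \<epsilon>(1,4,3)] by simp
qed

text \<open>A7 on profiles, with the constants \<open>c\<close> and \<open>d\<close> in the roles of
  \<open>x\<close> and \<open>y\<close>.\<close>

lemma Q_bridge:
  assumes s: "simple \<phi>" "simple \<psi>"
    and h: "\<not> Q \<phi> (\<lambda>s. c)" "\<not> Q (\<lambda>s. c) \<phi>" "Q (\<lambda>s. c) \<psi>" "\<not> Q \<psi> (\<lambda>s. d)" "\<not> Q (\<lambda>s. d) \<psi>" "Q \<phi> (\<lambda>s. d)"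
  shows "Q \<phi> \<psi>"
proof -
  obtain \<epsilon> where \<epsilon>: "0 < \<epsilon>" "fits \<epsilon> \<phi>" "fits \<epsilon> \<psi>" "fits \<epsilon> (\<lambda>s. c)" "fits \<epsilon> (\<lambda>s. d)"
    using fits_ex[of "{\<phi>, \<psi>, \<lambda>s. c, \<lambda>s. d}"] s simple_const[of c] simple_const[of d] by auto
  have cd: "seg a b (\<epsilon> * c) \<in> X" "seg a b (\<epsilon> * d) \<in> X"
    using fits_le[OF \<epsilon>(4)] fits_le[OF \<epsilon>(5)] by (auto intro: seg_in[OF X ab(1,2)])
  note iff = Q_fits[OF \<epsilon>(1)] and acts = sa_fits[OF \<epsilon>(2)] sa_fits[OF \<epsilon>(3)]
  have "incomp R (sa (\<lambda>s. \<epsilon> * \<phi> s)) (cact (seg a b (\<epsilon> * c)))"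
    "R (cact (seg a b (\<epsilon> * c))) (sa (\<lambda>s. \<epsilon> * \<psi> s))"
    "incomp R (sa (\<lambda>s. \<epsilon> * \<psi> s)) (cact (seg a b (\<epsilon> * d)))"
    "R (sa (\<lambda>s. \<epsilon> * \<phi> s)) (cact (seg a b (\<epsilon> * d)))"
    using h by (auto simp: iff \<epsilon> incomp_def sa_const)
  then have "R (sa (\<lambda>s. \<epsilon> * \<phi> s)) (sa (\<lambda>s. \<epsilon> * \<psi> s))"
    using A7 acts cd unfolding A7_def by blast
  then show ?thesis by (simp add: iff \<epsilon>)
qed

section \<open>The functional \<open>I\<close> and the priors it determines\<close>

definition I :: "('a \<Rightarrow> real) \<Rightarrow> real" where
  "I \<phi> = Sup {t. Q \<phi> (\<lambda>s. t)}"

text \<open>The constants below \<phi> form a nonempty down-set, bounded because \<phi> is, and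
  without a largest element by \<open>Q_open\<close>. It is therefore the open ray below its
  supremum.\<close>

lemma Q_const_right_iff:
  assumes s: "simple \<phi>"
  shows "Q \<phi> (\<lambda>s. t) \<longleftrightarrow> t < I \<phi>"
proof -
  obtain M where M: "M > 0" "\<And>s. \<bar>\<phi> s\<bar> \<le> M" using simp_fun_bounded[OF s] by blast
  have le: "- M \<le> \<phi> s" "\<phi> s \<le> M" for s using M(2)[of s] by linarith+
  have ub: "x \<le> M" if "x \<in> {t. Q \<phi> (\<lambda>s. t)}" for x
    using Q_mono[OF s simple_const simple_const simple_const, of x M x] that le Q_const[of M x] by auto
  have "Q \<phi> (\<lambda>s. - M - 1)"
    using Q_mono[OF simple_const simple_const s simple_const, of "- M" "- M - 1" "- M - 1"] le
      Q_const[of "- M" "- M - 1"] by auto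
  then have ne: "{t. Q \<phi> (\<lambda>s. t)} \<noteq> {}" by blast
  have bdd: "bdd_above {t. Q \<phi> (\<lambda>s. t)}" using ub by (rule bdd_aboveI)
  show ?thesis
  proof
    assume Q: "Q \<phi> (\<lambda>s. t)"
    obtain \<delta> where \<delta>: "\<delta> > 0" "Q (\<lambda>s. \<phi> s - \<delta>) (\<lambda>s. t)" using Q_open[OF s simple_const Q] by blast
    then have "Q \<phi> (\<lambda>s. t + \<delta>)"
      using Q_shift[of "\<lambda>s. \<phi> s - \<delta>" "\<lambda>s. t" \<delta>] simple_affine[OF s, of 1 "- \<delta>"] simple_const[of t] by simp
    then have "t + \<delta> \<le> I \<phi>" unfolding I_def using bdd by (intro cSup_upper) auto
    then show "t < I \<phi>" using \<delta> by simp
  next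
    assume "t < I \<phi>"
    then obtain r where "t < r" "Q \<phi> (\<lambda>s. r)"
      unfolding I_def using less_cSup_iff[OF ne bdd] by auto
    then show "Q \<phi> (\<lambda>s. t)" using Q_mono[OF s simple_const s simple_const] by simp
  qed
qed

lemma I_mono:
  assumes s: "simple \<phi>" "simple \<psi>" and le: "\<And>s. \<phi> s \<le> \<psi> s"
  shows "I \<phi> \<le> I \<psi>"
proof (rule dense_ge)
  fix t assume "I \<psi> < t"
  then have "\<not> Q \<psi> (\<lambda>s. t)" using Q_const_right_iff[OF s(2)] by simp
  then have "\<not> Q \<phi> (\<lambda>s. t)" using Q_mono[OF s(1) simple_const s(2) simple_const] le by blast
  then show "I \<phi> \<le> t" using Q_const_right_iff[OF s(1)] by simp
qed

lemma I_const: "I (\<lambda>s. c) = c"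
proof -
  have "t < I (\<lambda>s. c) \<longleftrightarrow> t < c" for t
    using Q_const_right_iff[OF simple_const[of c], of t] Q_const[of c t] by simp
  from this[of "I (\<lambda>s. c)"] this[of c] show ?thesis by simp
qed

lemma I_affine:
  assumes s: "simple \<phi>" and c: "0 \<le> c"
  shows "I (\<lambda>s. c * \<phi> s + d) = c * I \<phi> + d"
proof (cases "c = 0")
  case True
  then show ?thesis using I_const by simp
next
  case False
  then have c: "0 < c" using c by simp
  have "t < I (\<lambda>s. c * \<phi> s + d) \<longleftrightarrow> t < c * I \<phi> + d" for t
  proof -
    have "t < I (\<lambda>s. c * \<phi> s + d) \<longleftrightarrow> Q (\<lambda>s. c * \<phi> s + d) (\<lambda>s. c * ((t - d) / c) + d)"
      using Q_const_right_iff[OF simple_affine[OF s]] c by simp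
    also have "\<dots> \<longleftrightarrow> Q (\<lambda>s. c * \<phi> s) (\<lambda>s. c * ((t - d) / c))"
      by (rule Q_shift[OF simp_scale[OF s] simple_const])
    also have "\<dots> \<longleftrightarrow> Q \<phi> (\<lambda>s. (t - d) / c)" by (rule Q_scale[OF s simple_const c])
    also have "\<dots> \<longleftrightarrow> (t - d) / c < I \<phi>" by (rule Q_const_right_iff[OF s])
    also have "\<dots> \<longleftrightarrow> t < c * I \<phi> + d" using c by (simp add: divide_simps algebra_simps)
    finally show ?thesis .
  qed
  from this[of "I (\<lambda>s. c * \<phi> s + d)"] this[of "c * I \<phi> + d"] show ?thesis by simp
qed

lemma I_superadd:
  assumes s: "simple \<phi>" "simple \<psi>"
  shows "I \<phi> + I \<psi> \<le> I (\<lambda>s. \<phi> s + \<psi> s)"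
proof (rule field_le_epsilon)
  fix e :: real assume e: "0 < e"
  \<comment> \<open>Constants slightly below the two values make both shifted profiles preferred to
    0, so \<open>Q_add\<close> applies; the total slack is \<open>e\<close>.\<close>
  define t r where "t = I \<phi> - e / 2" and "r = I \<psi> - e / 2"
  have s': "simple (\<lambda>s. 1 * \<phi> s + (- t))" "simple (\<lambda>s. 1 * \<psi> s + (- r))"
    "simple (\<lambda>s. 1 * (\<phi> s + \<psi> s) + (- t - r))"
    by (rule simple_affine[OF s(1)], rule simple_affine[OF s(2)], rule simple_affine[OF simple_plus[OF s]])
  have "Q (\<lambda>s. 1 * \<phi> s + (- t)) (\<lambda>s. 0)" "Q (\<lambda>s. 1 * \<psi> s + (- r)) (\<lambda>s. 0)"
    using Q_const_right_iff[OF s'(1), of 0] Q_const_right_iff[OF s'(2), of 0]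
      I_affine[OF s(1), of 1 "- t"] I_affine[OF s(2), of 1 "- r"] e by (auto simp: t_def r_def)
  from Q_add[OF s'(1,2) this] have "Q (\<lambda>s. 1 * (\<phi> s + \<psi> s) + (- t - r)) (\<lambda>s. 0)"
    by (simp add: algebra_simps)
  then have "0 < I (\<lambda>s. \<phi> s + \<psi> s) - t - r"
    using Q_const_right_iff[OF s'(3), of 0] I_affine[OF simple_plus[OF s], of 1 "- t - r"] by simp
  then show "I \<phi> + I \<psi> \<le> I (\<lambda>s. \<phi> s + \<psi> s) + e" by (simp add: t_def r_def)
qed

text \<open>Shifting by \<open>- t\<close> reduces the comparison to one with 0, and reflection
  expresses the upper threshold through \<open>I\<close>.\<close>

lemma Q_const_left_iff:
  assumes s: "simple \<phi>"
  shows "Q (\<lambda>s. t) \<phi> \<longleftrightarrow> - I (\<lambda>s. - \<phi> s) < t"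
proof -
  have s': "simple (\<lambda>s. 1 * \<phi> s + (- t))" "simple (\<lambda>s. (-1) * \<phi> s + t)" "simple (\<lambda>s. (-1) * \<phi> s)"
    by (rule simple_affine[OF s], rule simple_affine[OF s], rule simp_scale[OF s])
  have "Q (\<lambda>s. t) \<phi> \<longleftrightarrow> Q (\<lambda>s. 0) (\<lambda>s. - ((-1) * \<phi> s + t))"
    using Q_shift[OF simple_const s, of t "- t"] by simp
  also have "\<dots> \<longleftrightarrow> Q (\<lambda>s. (-1) * \<phi> s + t) (\<lambda>s. 0)" by (rule Q_reflect[OF s'(2)])
  also have "\<dots> \<longleftrightarrow> 0 < I (\<lambda>s. (-1) * \<phi> s + t)" by (rule Q_const_right_iff[OF s'(2)])
  also have "\<dots> \<longleftrightarrow> 0 < I (\<lambda>s. - \<phi> s) + t" using I_affine[OF s'(3), of 1 t] by simp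
  finally show ?thesis by auto
qed

text \<open>Forwards, transitivity gives weak inequalities for the profile lowered by a small
  constant, and that constant makes them strict. Backwards, \<open>Q_bridge\<close> applies.\<close>

lemma Q_iff_I:
  assumes s: "simple \<phi>" "simple \<psi>"
  shows "Q \<phi> \<psi> \<longleftrightarrow> I \<psi> < I \<phi> \<and> - I (\<lambda>s. - \<psi> s) < - I (\<lambda>s. - \<phi> s)"
proof
  assume "Q \<phi> \<psi>"
  then obtain \<delta> where \<delta>: "\<delta> > 0" "Q (\<lambda>s. \<phi> s - \<delta>) \<psi>" using Q_open[OF s] by blast
  have s': "simple (\<lambda>s. \<phi> s - \<delta>)" "simple (\<lambda>s. - \<phi> s)"
    using simple_affine[OF s(1), of 1 "- \<delta>"] simp_scale[OF s(1), of "-1"] by auto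
  have I\<delta>: "I (\<lambda>s. \<phi> s - \<delta>) = I \<phi> - \<delta>" using I_affine[OF s(1), of 1 "- \<delta>"] by simp
  have J\<delta>: "I (\<lambda>s. - (\<phi> s - \<delta>)) = I (\<lambda>s. - \<phi> s) + \<delta>"
    using I_affine[OF s'(2), of 1 \<delta>] by (simp add: algebra_simps)
  have "I \<psi> \<le> I \<phi> - \<delta>"
  proof (rule dense_le)
    fix t assume "t < I \<psi>"
    then have "Q (\<lambda>s. \<phi> s - \<delta>) (\<lambda>s. t)"
      using Q_trans[OF s'(1) s(2) simple_const \<delta>(2)] Q_const_right_iff[OF s(2)] by blast
    then show "t \<le> I \<phi> - \<delta>" using Q_const_right_iff[OF s'(1)] I\<delta> by simp
  qed
  moreover have "- I (\<lambda>s. - \<psi> s) \<le> - I (\<lambda>s. - \<phi> s) - \<delta>"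
  proof (rule dense_ge)
    fix t assume "- I (\<lambda>s. - \<phi> s) - \<delta> < t"
    then have "Q (\<lambda>s. t) (\<lambda>s. \<phi> s - \<delta>)" using Q_const_left_iff[OF s'(1)] J\<delta> by simp
    then have "Q (\<lambda>s. t) \<psi>" using Q_trans[OF simple_const s'(1) s(2) _ \<delta>(2)] by blast
    then show "- I (\<lambda>s. - \<psi> s) \<le> t" using Q_const_left_iff[OF s(2)] by simp
  qed
  ultimately show "I \<psi> < I \<phi> \<and> - I (\<lambda>s. - \<psi> s) < - I (\<lambda>s. - \<phi> s)" using \<delta>(1) by linarith
next
  assume *: "I \<psi> < I \<phi> \<and> - I (\<lambda>s. - \<psi> s) < - I (\<lambda>s. - \<phi> s)"
  have IJ: "I \<xi> \<le> - I (\<lambda>s. - \<xi> s)" if "simple \<xi>" for \<xi>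
    using I_superadd[OF that simp_scale[OF that, of "-1"]] I_const[of 0] by simp
  show "Q \<phi> \<psi>"
    \<comment> \<open>The bridging constants are the upper threshold of \<phi> and the lower
      threshold of \<psi>: each is incomparable to its own profile and strictly compared with the
      other.\<close>
    by (rule Q_bridge[OF s, of "- I (\<lambda>s. - \<phi> s)" "I \<psi>"])
      (use * IJ[OF s(1)] IJ[OF s(2)] in \<open>auto simp: Q_const_right_iff Q_const_left_iff s\<close>)
qed

lemma hp_rep_exists: "\<exists>C. hp_rep Sig X R u C C"
proof -
  \<comment> \<open>The probabilities dominating \<open>I\<close>. By
    \<open>superlinear_supported\<close> the bound is attained for each profile, so the minimum over
    this set is \<open>I\<close>.\<close>
  define C where "C = fa_probs Sig \<inter> (\<Inter>\<phi>\<in>{\<phi>. simple \<phi>}. {p. I \<phi> \<le> sint p \<phi>})"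
  have att: "\<exists>p\<in>C. sint p \<phi> = I \<phi>" if s: "simple \<phi>" for \<phi>
  proof -
    have "\<exists>p. p \<in> fa_probs Sig \<and> (\<forall>\<phi>. simple \<phi> \<longrightarrow> I \<phi> \<le> sint p \<phi>) \<and> sint p \<phi> = I \<phi>"
    proof (rule superlinear_supported[OF Sig s, of I])
      show "I \<phi> + I \<psi> \<le> I (\<lambda>s. \<phi> s + \<psi> s)" if "simple \<phi>" "simple \<psi>" for \<phi> \<psi>
        using that by (rule I_superadd)
      show "I \<phi> \<le> I \<psi>" if "simple \<phi>" "simple \<psi>" "\<And>s. \<phi> s \<le> \<psi> s" for \<phi> \<psi>
        using that by (rule I_mono)
      show "I (\<lambda>s. c * \<phi> s + d) = c * I \<phi> + d" if "simple \<phi>" "0 \<le> c" for \<phi> c d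
        using that by (rule I_affine)
    qed blast
    then show ?thesis by (auto simp: C_def)
  qed
  have "closed {p. I \<phi> \<le> sint p \<phi>}" for \<phi>
    by (intro closed_Collect_le continuous_on_const continuous_on_sint)
  then have comp: "compact C" unfolding C_def
    by (intro compact_Int_closed compact_fa_probs[OF Sig] closed_INT) auto
  have conv: "convex_meas C"
    unfolding convex_meas_def
  proof (intro ballI allI impI)
    fix p q and \<alpha> :: real assume pq: "p \<in> C" "q \<in> C" and \<alpha>: "0 \<le> \<alpha> \<and> \<alpha> \<le> 1"
    have "(\<lambda>A. \<alpha> * p A + (1 - \<alpha>) * q A) \<in> fa_probs Sig"
      using convex_fa_probs[OF Sig] pq \<alpha> by (auto simp: convex_meas_def C_def)
    moreover have "I \<phi> \<le> sint (\<lambda>A. \<alpha> * p A + (1 - \<alpha>) * q A) \<phi>" if "simple \<phi>" for \<phi>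
    proof -
      have "I \<phi> \<le> sint p \<phi>" "I \<phi> \<le> sint q \<phi>" using pq that by (auto simp: C_def)
      then have "\<alpha> * I \<phi> + (1 - \<alpha>) * I \<phi> \<le> \<alpha> * sint p \<phi> + (1 - \<alpha>) * sint q \<phi>"
        using \<alpha> by (intro add_mono mult_left_mono) auto
      then show ?thesis unfolding sint_mix by (simp add: algebra_simps)
    qed
    ultimately show "(\<lambda>A. \<alpha> * p A + (1 - \<alpha>) * q A) \<in> C" by (auto simp: C_def)
  qed
  have ne: "C \<noteq> {}" using att[OF simple_const[of 0]] by blast
  interpret P: priors Sig C
    by (rule priors.intro[OF Sig _ comp ne]) (auto simp: C_def)
  have min: "minf C \<phi> = I \<phi>" if "simple \<phi>" for \<phi>
  proof (rule antisym)
    show "minf C \<phi> \<le> I \<phi>" using att[OF that] P.minf_le by metis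
    show "I \<phi> \<le> minf C \<phi>" unfolding P.le_minf_iff using that by (auto simp: C_def)
  qed
  have "R f g \<longleftrightarrow> (minEU C u f > minEU C u g \<and> maxEU C u f > maxEU C u g)" if fg: "f \<in> acts" "g \<in> acts" for f g
  proof -
    have s: "simple (\<lambda>s. u (f s))" "simple (\<lambda>s. u (g s))" "simple (\<lambda>s. - u (f s))" "simple (\<lambda>s. - u (g s))"
      using fg simp_fun_utility[OF Sig, of _ X u] simp_fun_utility[OF Sig, of _ X "\<lambda>x. - u x"] by auto
    show ?thesis
      unfolding R_iff_Q[OF fg] Q_iff_I[OF s(1,2)] minEU_eq maxEU_eq P.maxf_eq[OF s(1)] P.maxf_eq[OF s(2)]
      by (simp add: min s)
  qed
  moreover have "nonconst_on X u" unfolding nonconst_on_def using ab by force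
  ultimately have "hp_rep Sig X R u C C"
    unfolding hp_rep_def using u comp conv ne by (auto simp: C_def)
  then show ?thesis by blast
qed

end

section \<open>Assembly of the characterisation\<close>

text \<open>Restricted to constant acts, A1 to A3 are the hypotheses of
  \<open>mixture_space_utility\<close>, whose normalised utility instantiates
  \<open>hp_axioms\<close>.\<close>

lemma hp_rep_of_axioms:
  assumes Sig: "algebra UNIV Sig" and X: "convex X"
    and A: "A1 Sig X R" "A2 Sig X R" "A3 Sig X R" "A4 Sig X R" "A5 Sig X R" "A7 Sig X R" "A8 Sig X R" "A9 Sig X R"
  shows "\<exists>u C. hp_rep Sig X R u C C"
proof -
  note act = cact_in_acts[OF Sig]
  have mix: "cact (\<alpha> *\<^sub>R x + (1 - \<alpha>) *\<^sub>R y) = mixa \<alpha> (cact x) (cact y)" for \<alpha> x y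
    by (simp add: cact_def mixa_def)
  have asym: "\<not> R g f" if "f \<in> simple_acts Sig X" "g \<in> simple_acts Sig X" "R f g" for f g
  proof -
    have "\<forall>f\<in>simple_acts Sig X. \<forall>g\<in>simple_acts Sig X. R f g \<longrightarrow> \<not> R g f"
      using A(1) unfolding A1_def by (elim conjE)
    then show ?thesis using that by blast
  qed
  have neg: "\<not> R (cact x) (cact z)"
    if "x \<in> X" "y \<in> X" "z \<in> X" "\<not> R (cact x) (cact y)" "\<not> R (cact y) (cact z)" for x y z
  proof -
    have "\<forall>x\<in>X. \<forall>y\<in>X. \<forall>z\<in>X. \<not> R (cact x) (cact y) \<and> \<not> R (cact y) (cact z) \<longrightarrow> \<not> R (cact x) (cact z)"
      using A(1) unfolding A1_def by (elim conjE)
    then show ?thesis using that by blast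
  qed
  obtain a b where ab: "a \<in> X" "b \<in> X" "R (cact b) (cact a)"
    using A(1) unfolding A1_def by blast
  have "\<exists>u. affine_on X u \<and> (\<forall>x\<in>X. \<forall>y\<in>X. R (cact x) (cact y) \<longleftrightarrow> u y < u x) \<and> u a = -1 \<and> u b = 1"
  proof (rule mixture_space_utility[of X "\<lambda>x y. R (cact x) (cact y)" a b])
    show "\<not> R (cact y) (cact x)" if "x \<in> X" "y \<in> X" "R (cact x) (cact y)" for x y
      using asym[OF act[OF that(1)] act[OF that(2)] that(3)] .
    show "\<not> R (cact x) (cact z)"
      if "x \<in> X" "y \<in> X" "z \<in> X" "\<not> R (cact x) (cact y)" "\<not> R (cact y) (cact z)" for x y z
      using that by (rule neg)
    show "R (cact x) (cact y) \<longleftrightarrow>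
        R (cact (\<alpha> *\<^sub>R x + (1 - \<alpha>) *\<^sub>R z)) (cact (\<alpha> *\<^sub>R y + (1 - \<alpha>) *\<^sub>R z))"
      if "x \<in> X" "y \<in> X" "z \<in> X" "0 < \<alpha>" "\<alpha> < 1" for x y z and \<alpha> :: real
      unfolding mix using that
      by (intro A(3)[unfolded A3_def, rule_format] act) auto
    show "openin (top_of_set {0..1}) {\<alpha>\<in>{0..1}. R (cact (\<alpha> *\<^sub>R x + (1 - \<alpha>) *\<^sub>R y)) (cact z)}"
      "openin (top_of_set {0..1}) {\<alpha>\<in>{0..1}. R (cact z) (cact (\<alpha> *\<^sub>R x + (1 - \<alpha>) *\<^sub>R y))}"
      if "x \<in> X" "y \<in> X" "z \<in> X" for x y z
      unfolding mix using A(2) act[OF that(1)] act[OF that(2)] act[OF that(3)] unfolding A2_def by simp_all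
    show "\<exists>u. affine_on X u \<and> (\<forall>x\<in>X. \<forall>y\<in>X. R (cact x) (cact y) \<longleftrightarrow> u y < u x) \<and> u a = -1 \<and> u b = 1"
      if "affine_on X u" "\<And>x y. x \<in> X \<Longrightarrow> y \<in> X \<Longrightarrow> R (cact x) (cact y) \<longleftrightarrow> u y < u x" "u a = -1" "u b = 1" for u
      using that by (intro exI[of _ u]) simp
  qed (rule X ab)+
  then obtain u where u: "affine_on X u" "\<And>x y. x \<in> X \<Longrightarrow> y \<in> X \<Longrightarrow> R (cact x) (cact y) \<longleftrightarrow> u y < u x"
    "u a = -1" "u b = 1" by (elim exE conjE) simp
  have "hp_axioms Sig X R u a b"
    by (rule hp_axioms.intro) (fact Sig X A u ab)+
  from hp_axioms.hp_rep_exists[OF this] show ?thesis by (rule exI[of _ u])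
qed

theorem theorem2:
  fixes Sig :: "'a set set" and X :: "'b::real_vector set"
    and R :: "('a \<Rightarrow> 'b) \<Rightarrow> ('a \<Rightarrow> 'b) \<Rightarrow> bool"
  assumes Sig: "algebra UNIV Sig"
    and X_convex: "convex X" and X_nonsingleton: "\<exists>x\<in>X. \<exists>y\<in>X. x \<noteq> y"
    and R_on_F: "\<forall>f g. R f g \<longrightarrow> f \<in> simple_acts Sig X \<and> g \<in> simple_acts Sig X"
  shows "(\<forall>u C D. hp_rep Sig X R u C D \<and> hp_rep_unique Sig X R u C D \<longrightarrow>
            (A8 Sig X R \<longleftrightarrow> D \<subseteq> C) \<and> (A9 Sig X R \<longleftrightarrow> C \<subseteq> D))
         \<and>
         ((A1 Sig X R \<and> A2 Sig X R \<and> A3 Sig X R \<and> A4 Sig X R \<and> A5 Sig X R \<and>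
           A6 Sig X R \<and> A7 Sig X R \<and> A8 Sig X R \<and> A9 Sig X R)
          \<longleftrightarrow>
          (\<exists>u C. hp_rep Sig X R u C C \<and>
             (\<forall>u' C'. hp_rep Sig X R u' C' C' \<longrightarrow> pos_affine_trans X u u' \<and> C' = C)))"
proof -
  have hp: "hope_prepare Sig X R u C D" if "hp_rep Sig X R u C D" for u C D
    using Sig X_convex that by (rule hope_prepare.intro)
  have unique: "pos_affine_trans X u u' \<and> C' = C"
    if "hp_rep Sig X R u C C" "hp_rep Sig X R u' C' C'" for u C u' C'
    using hp_rep_unique_priors[OF hp hp, OF that] hp_rep_unique_priors(2)[OF hp hp, OF that(2,1)] by blast
  have iffs: "(A8 Sig X R \<longleftrightarrow> D \<subseteq> C) \<and> (A9 Sig X R \<longleftrightarrow> C \<subseteq> D)" if "hp_rep Sig X R u C D" for u C D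
    using hope_prepare.A8_iff[OF hp[OF that]] hope_prepare.A9_iff[OF hp[OF that]] by blast
  have "A1 Sig X R \<and> A2 Sig X R \<and> A3 Sig X R \<and> A4 Sig X R \<and> A5 Sig X R \<and>
      A6 Sig X R \<and> A7 Sig X R \<and> A8 Sig X R \<and> A9 Sig X R" if "hp_rep Sig X R u C C" for u C
  proof -
    interpret hope_prepare Sig X R u C C by (rule hp[OF that])
    show ?thesis using A1 A2 A3 A4 A5 A6 A7 A8_iff A9_iff by blast
  qed
  moreover have "\<exists>u C. hp_rep Sig X R u C C"
    if "A1 Sig X R \<and> A2 Sig X R \<and> A3 Sig X R \<and> A4 Sig X R \<and> A5 Sig X R \<and>
      A6 Sig X R \<and> A7 Sig X R \<and> A8 Sig X R \<and> A9 Sig X R"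
    using that by (intro hp_rep_of_axioms Sig X_convex) simp_all
  ultimately have eq: "(A1 Sig X R \<and> A2 Sig X R \<and> A3 Sig X R \<and> A4 Sig X R \<and> A5 Sig X R \<and>
      A6 Sig X R \<and> A7 Sig X R \<and> A8 Sig X R \<and> A9 Sig X R) \<longleftrightarrow> (\<exists>u C. hp_rep Sig X R u C C)"
    by blast
  show ?thesis
  proof (intro conjI allI impI)
    fix u C D assume h: "hp_rep Sig X R u C D \<and> hp_rep_unique Sig X R u C D"
    show "A8 Sig X R \<longleftrightarrow> D \<subseteq> C" "A9 Sig X R \<longleftrightarrow> C \<subseteq> D" using iffs[of u C D] h by auto
  next
    \<comment> \<open>Any two representations with a single set of priors agree by
      \<open>unique\<close>, so the uniqueness clause follows from existence.\<close>
    have "(\<exists>u C. hp_rep Sig X R u C C) \<longleftrightarrow> (\<exists>u C. hp_rep Sig X R u C C \<and>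
        (\<forall>u' C'. hp_rep Sig X R u' C' C' \<longrightarrow> pos_affine_trans X u u' \<and> C' = C))"
    proof
      assume "\<exists>u C. hp_rep Sig X R u C C"
      then obtain u C where h: "hp_rep Sig X R u C C" by (elim exE)
      show "\<exists>u C. hp_rep Sig X R u C C \<and>
          (\<forall>u' C'. hp_rep Sig X R u' C' C' \<longrightarrow> pos_affine_trans X u u' \<and> C' = C)"
        by (rule exI[of _ u], rule exI[of _ C], rule conjI[OF h]) (intro allI impI unique[OF h])
    next
      assume "\<exists>u C. hp_rep Sig X R u C C \<and>
          (\<forall>u' C'. hp_rep Sig X R u' C' C' \<longrightarrow> pos_affine_trans X u u' \<and> C' = C)"
      then show "\<exists>u C. hp_rep Sig X R u C C" by (elim exE conjE) (intro exI)
    qed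
    with eq show "(A1 Sig X R \<and> A2 Sig X R \<and> A3 Sig X R \<and> A4 Sig X R \<and> A5 Sig X R \<and>
        A6 Sig X R \<and> A7 Sig X R \<and> A8 Sig X R \<and> A9 Sig X R) \<longleftrightarrow> (\<exists>u C. hp_rep Sig X R u C C \<and>
        (\<forall>u' C'. hp_rep Sig X R u' C' C' \<longrightarrow> pos_affine_trans X u u' \<and> C' = C))"
      by (rule trans)
  qed
qed

end
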